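(* Let $P$ be a closed cone of a Banach space $X$. Then $P$ is reflexive if and only if $P$ does not contain a closed cone isomorphic to $\ell_1^+$, the positive cone of $\ell_1$.
   Context: All spaces are real. $B_X$ is the closed unit ball of $X$. A cone of $X$ is a nonempty convex set $P\subseteq X$ with $\lambda P\subseteq P$ for every real $\lambda\ge 0$ (it need not be pointed). A cone $P$ of a Banach space $X$ is reflexive if $P\cap B_X$ is weakly compact. $\ell_1^+=\{(\xi_i)\in\ell_1:\xi_i\ge 0\text{ for all } i\}$. If $Y,Z$ are normed spaces, a cone $P\subseteq Y$ is isomorphic to a cone $K\subseteq Z$ if there is an additive, positively homogeneous, one-to-one map $T$ of $P$ onto $K$ such that $T$ and $T^{-1}$ are continuous in the induced (norm) topologies. *)

theory Defs
  imports "HOL-Analysis.Analysis"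
begin

definition weak_topology :: "'a::real_normed_vector topology" where
  "weak_topology = topology_generated_by
     {f -` U | (f :: 'a \<Rightarrow> real) U. bounded_linear f \<and> open U}"

definition reflexive_cone :: "'a::real_normed_vector set \<Rightarrow> bool" where
  "reflexive_cone P \<longleftrightarrow> convex_cone P \<and> compactin weak_topology (P \<inter> cball 0 1)"

definition cone_isomorphic ::
  "'a::real_normed_vector set \<Rightarrow> 'b::real_normed_vector set \<Rightarrow> bool" where
  "cone_isomorphic P K \<longleftrightarrow>
     (\<exists>T. bij_betw T P K \<and>
          (\<forall>x\<in>P. \<forall>y\<in>P. T (x + y) = T x + T y) \<and>
          (\<forall>x\<in>P. \<forall>c\<ge>0. T (c *\<^sub>R x) = c *\<^sub>R T x) \<and>
          continuous_on P T \<and> continuous_on K (inv_into P T))"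

text \<open>The space of absolutely summable real sequences with the norm
  \<open>\<parallel>x\<parallel> = (\<Sum>i. \<bar>x i\<bar>)\<close>; sequences are indexed from 0.\<close>

typedef l1 = "{x :: nat \<Rightarrow> real. summable (\<lambda>i. \<bar>x i\<bar>)}"
  morphisms l1_nth Abs_l1
  by (rule exI[of _ "\<lambda>_. 0"]) simp

setup_lifting type_definition_l1

lemma summable_l1_nth: "summable (\<lambda>i. \<bar>l1_nth x i\<bar>)"
  using l1_nth[of x] by simp

lemma l1_eqI: "(\<And>i. l1_nth x i = l1_nth y i) \<Longrightarrow> x = y"
  by (simp add: l1_nth_inject[symmetric] fun_eq_iff)

instantiation l1 :: real_normed_vector
begin

lift_definition zero_l1 :: l1 is "\<lambda>_. 0"
  by simp

lift_definition plus_l1 :: "l1 \<Rightarrow> l1 \<Rightarrow> l1" is "\<lambda>x y i. x i + y i"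
  subgoal for x y
    by (rule summable_comparison_test'[of "\<lambda>i. \<bar>x i\<bar> + \<bar>y i\<bar>" 0])
       (auto intro: summable_add)
  done

lift_definition uminus_l1 :: "l1 \<Rightarrow> l1" is "\<lambda>x i. - x i"
  by simp

lift_definition minus_l1 :: "l1 \<Rightarrow> l1 \<Rightarrow> l1" is "\<lambda>x y i. x i - y i"
  subgoal for x y
    by (rule summable_comparison_test'[of "\<lambda>i. \<bar>x i\<bar> + \<bar>y i\<bar>" 0])
       (auto intro: summable_add)
  done

lift_definition scaleR_l1 :: "real \<Rightarrow> l1 \<Rightarrow> l1" is "\<lambda>c x i. c * x i"
  by (simp add: abs_mult summable_mult)

definition norm_l1 :: "l1 \<Rightarrow> real" where
  "norm_l1 x = (\<Sum>i. \<bar>l1_nth x i\<bar>)"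

definition sgn_l1 :: "l1 \<Rightarrow> l1" where
  "sgn_l1 x = scaleR (inverse (norm x)) x"

definition dist_l1 :: "l1 \<Rightarrow> l1 \<Rightarrow> real" where
  "dist_l1 x y = norm (x - y)"

definition uniformity_l1 :: "(l1 \<times> l1) filter" where
  [code del]: "uniformity_l1 = (INF e\<in>{0<..}. principal {(x, y). dist x y < e})"

definition open_l1 :: "l1 set \<Rightarrow> bool" where
  [code del]: "open_l1 S \<longleftrightarrow> (\<forall>x\<in>S. \<forall>\<^sub>F (x', y) in uniformity. x' = x \<longrightarrow> y \<in> S)"

instance
proof
  fix x y z :: l1 and a b :: real
  show "x + y + z = x + (y + z)" "x + y = y + x" "0 + x = x" "- x + x = 0" "x - y = x + - y"
    by (transfer; simp add: fun_eq_iff)+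
  show "a *\<^sub>R (x + y) = a *\<^sub>R x + a *\<^sub>R y" "(a + b) *\<^sub>R x = a *\<^sub>R x + b *\<^sub>R x"
       "a *\<^sub>R b *\<^sub>R x = (a * b) *\<^sub>R x" "1 *\<^sub>R x = x"
    by (transfer; simp add: fun_eq_iff algebra_simps)+
  show "dist x y = norm (x - y)" by (rule dist_l1_def)
  show "sgn x = inverse (norm x) *\<^sub>R x" by (rule sgn_l1_def)
  show "uniformity = (INF e\<in>{0<..}. principal {(x :: l1, y). dist x y < e})"
    by (rule uniformity_l1_def)
  show "open S \<longleftrightarrow> (\<forall>x\<in>S. \<forall>\<^sub>F (x', y) in uniformity. x' = x \<longrightarrow> y \<in> S)" for S :: "l1 set"
    by (rule open_l1_def)
  show "norm x = 0 \<longleftrightarrow> x = 0"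
    unfolding norm_l1_def suminf_eq_zero_iff[OF summable_l1_nth abs_ge_zero]
    by transfer (simp add: fun_eq_iff)
  have "norm (x + y) \<le> (\<Sum>i. \<bar>l1_nth x i\<bar> + \<bar>l1_nth y i\<bar>)"
    unfolding norm_l1_def
    by (intro suminf_le summable_add summable_l1_nth) (simp add: plus_l1.rep_eq abs_triangle_ineq)
  then show "norm (x + y) \<le> norm x + norm y"
    by (simp add: norm_l1_def suminf_add summable_l1_nth)
  show "norm (a *\<^sub>R x) = \<bar>a\<bar> * norm x"
    by (simp add: norm_l1_def scaleR_l1.rep_eq abs_mult suminf_mult summable_l1_nth)
qed

end

definition l1_pos :: "l1 set" where
  "l1_pos = {x. \<forall>i. 0 \<le> l1_nth x i}"

end

theory Submission
  imports Defs
begin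

text \<open>
  Write \<open>B\<close> for the closed unit ball.

  If \<open>P\<close> contains a closed cone \<open>K\<close> isomorphic to \<open>\<ell>\<^sub>1\<^sup>+\<close>, pull back along the isomorphism the sets
  of positive sequences of a small fixed norm whose first \<open>N\<close> coordinates vanish.  Since the norm
  is additive on \<open>\<ell>\<^sub>1\<^sup>+\<close>, these are nonempty closed convex subsets of \<open>P \<inter> B\<close>, decreasing in \<open>N\<close>.
  They are weakly closed, and no point is common to all of them, because it would correspond to a
  sequence of positive norm all of whose coordinates vanish.  So \<open>P \<inter> B\<close> is not weakly compact
  (\<open>cone_isomorphic_l1_pos_not_reflexive\<close>).

  Conversely, let \<open>A = P \<inter> B\<close> fail to be weakly compact.  Inside the bidual, \<open>A\<close> then has a
  weak-star limit \<open>F\<close> which is not evaluation at a point of \<open>A\<close>; as \<open>A\<close> is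
  closed and convex, \<open>F\<close> even has positive distance from the whole space (\<open>non_weakly_compact_limit\<close>).
  Following James, choose alternately
  functionals \<open>f\<^sub>n\<close>, uniformly bounded, with \<open>F(f\<^sub>n) = 1\<close> which annihilate the earlier vectors \<open>x\<^sub>k\<close>,
  \<open>k < n\<close> (possible by Helly's theorem, \<open>helly\<close>), and vectors \<open>x\<^sub>n \<in> A\<close> on which \<open>f\<^sub>0, \<dots>, f\<^sub>n\<close> almost
  take the value 1 (possible since \<open>F\<close> is a limit of points of \<open>A\<close>); see \<open>james_sequence\<close>.
  Put \<open>T a = \<Sum>k. a\<^sub>k x\<^sub>k\<close>, a bounded operator from \<open>\<ell>\<^sub>1\<close> which maps \<open>\<ell>\<^sub>1\<^sup>+\<close> into \<open>P\<close>.  Up to a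
  summable error, \<open>f\<^sub>n - f\<^bsub>n+1\<^esub>\<close> reads off the coordinate \<open>a\<^sub>n\<close> from \<open>T a\<close>; hence all coordinates are
  uniformly controlled by the norm of \<open>T a\<close>, and \<open>T\<close> is injective (\<open>coordinate_le\<close>).
  On positive sequences, \<open>f\<^sub>n (T c)\<close> moreover lies between half and twice the tail mass
  \<open>\<Sum>k\<ge>n. c\<^sub>k\<close> (\<open>tail_bounds\<close>).  A Cauchy sequence in the image of \<open>\<ell>\<^sub>1\<^sup>+\<close> therefore has preimages
  with uniformly small tails and uniformly Cauchy coordinates, which makes them Cauchy in the
  norm of \<open>\<ell>\<^sub>1\<close>.  Completeness of \<open>\<ell>\<^sub>1\<close> then gives both that the image is closed and that the
  inverse of \<open>T\<close> is continuous on it.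

  The functional-analytic tool behind all separations is the Mazur--Orlicz form of the
  Hahn--Banach theorem (\<open>mazur_orlicz\<close>).
\<close>

section \<open>Linear minorants of sublinear functionals\<close>

text \<open>
  Homogeneity is only required for positive factors; the value 0 at 0 follows from it.
\<close>

definition sublinear :: "('a::real_vector \<Rightarrow> real) \<Rightarrow> bool" where
  "sublinear p \<longleftrightarrow> (\<forall>x y. p (x + y) \<le> p x + p y) \<and> (\<forall>c x. 0 < c \<longrightarrow> p (c *\<^sub>R x) = c * p x)"

lemma sublinearI:
  assumes "\<And>x y. p (x + y) \<le> p x + p y"
    and le: "\<And>c x. 0 < c \<Longrightarrow> p (c *\<^sub>R x) \<le> c * p x"
  shows "sublinear p"
proof -
  have "p (c *\<^sub>R x) = c * p x" if "0 < c" for c x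
  proof (rule antisym)
    have "p x = p (inverse c *\<^sub>R (c *\<^sub>R x))" using that by simp
    also have "\<dots> \<le> inverse c * p (c *\<^sub>R x)" by (rule le) (use that in simp)
    finally show "c * p x \<le> p (c *\<^sub>R x)" using that by (simp add: field_simps)
  qed (rule le[OF that])
  then show ?thesis using assms(1) by (simp add: sublinear_def)
qed

lemma sublinear_add: "sublinear p \<Longrightarrow> p (x + y) \<le> p x + p y"
  by (simp add: sublinear_def)

lemma sublinear_zero:
  assumes "sublinear p" shows "p 0 = 0"
proof -
  have "p (2 *\<^sub>R 0) = 2 * p 0" using assms unfolding sublinear_def by (meson zero_less_numeral)
  then show ?thesis by simp
qed

lemma sublinear_scale: "sublinear p \<Longrightarrow> 0 \<le> c \<Longrightarrow> p (c *\<^sub>R x) = c * p x"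
  using sublinear_zero[of p] by (cases "c = 0") (auto simp: sublinear_def)

lemma sublinear_lower: "sublinear p \<Longrightarrow> - p (- x) \<le> p x"
  using sublinear_add[of p x "- x"] sublinear_zero[of p] by simp

text \<open>
  Any sublinear \<open>q \<le> p\<close> with \<open>q (- b) \<le> - d\<close> on \<open>B\<close> satisfies \<open>q x \<le> p (x + t b) - t d\<close> for \<open>t \<ge> 0\<close>;
  the infimum of these bounds over \<open>t\<close> and \<open>b\<close> is itself such a functional.  The
  lower bound \<open>d \<le> p b\<close> keeps this infimum finite, and convexity of \<open>B\<close> keeps it subadditive.
\<close>

lemma sublinear_push_down:
  fixes p :: "'a::real_vector \<Rightarrow> real"
  assumes p: "sublinear p" and B: "convex B" "B \<noteq> {}" and d: "\<And>b. b \<in> B \<Longrightarrow> d \<le> p b"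
  obtains q where "sublinear q" "\<And>x. q x \<le> p x" "\<And>b. b \<in> B \<Longrightarrow> q (- b) \<le> - d"
proof -
  define V where "V x = {p (x + t *\<^sub>R b) - t * d | t b. 0 \<le> t \<and> b \<in> B}" for x
  define q where "q x = Inf (V x)" for x
  have bound: "- p (- x) \<le> v" if v: "v \<in> V x" for v x
  proof -
    obtain t b where t: "0 \<le> t" "b \<in> B" "v = p (x + t *\<^sub>R b) - t * d"
      using v by (auto simp: V_def)
    have "t * d \<le> p (t *\<^sub>R b)" using t d[of b] by (simp add: sublinear_scale[OF p] mult_left_mono)
    also have "\<dots> \<le> p (x + t *\<^sub>R b) + p (- x)"
      using sublinear_add[OF p, of "x + t *\<^sub>R b" "- x"] by simp
    finally show ?thesis using t by simp
  qed
  have bdd: "bdd_below (V x)" for x using bound by (rule bdd_belowI)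
  have low: "q x \<le> v" if "v \<in> V x" for v x
    unfolding q_def using that bdd by (rule cInf_lower)
  have le: "q x \<le> p (x + t *\<^sub>R b) - t * d" if "0 \<le> t" "b \<in> B" for x t b
    by (rule low) (use that in \<open>auto simp: V_def\<close>)
  have ne: "V x \<noteq> {}" for x using B(2) by (auto simp: V_def intro: exI[of _ 0])
  have approx: "\<exists>t b. 0 \<le> t \<and> b \<in> B \<and> p (x + t *\<^sub>R b) - t * d < q x + e" if "0 < e" for x e
  proof -
    have "Inf (V x) < q x + e" using that by (simp add: q_def)
    then obtain v where "v \<in> V x" "v < q x + e" using ne cInf_lessD by blast
    then show ?thesis by (auto simp: V_def)
  qed
  show ?thesis
  proof (rule that)
    show "sublinear q"
    proof (rule sublinearI)
      fix x y
      show "q (x + y) \<le> q x + q y"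
      proof (rule field_le_epsilon)
        fix e :: real assume e: "0 < e"
        obtain t b where t: "0 \<le> t" "b \<in> B" "p (x + t *\<^sub>R b) - t * d < q x + e/2"
          using approx[of "e/2" x] e by auto
        obtain s c where s: "0 \<le> s" "c \<in> B" "p (y + s *\<^sub>R c) - s * d < q y + e/2"
          using approx[of "e/2" y] e by auto
        \<comment> \<open>The cone over a convex set is closed under addition; if \<open>t + s = 0\<close>, any point of \<open>B\<close> serves.\<close>
        obtain b' where b': "b' \<in> B" "(t + s) *\<^sub>R b' = t *\<^sub>R b + s *\<^sub>R c"
        proof (cases "t + s = 0")
          case True then show ?thesis using t s that[of b] by (simp add: add_nonneg_eq_0_iff)
        next
          case False
          then have pos: "t + s > 0" using t s by simp
          show ?thesis
          proof (rule that)
            show "(t/(t+s)) *\<^sub>R b + (s/(t+s)) *\<^sub>R c \<in> B"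
              using t s pos by (intro convexD[OF B(1)]) (auto simp: add_divide_distrib[symmetric])
            show "(t + s) *\<^sub>R ((t/(t+s)) *\<^sub>R b + (s/(t+s)) *\<^sub>R c) = t *\<^sub>R b + s *\<^sub>R c"
              using pos by (simp add: scaleR_add_right)
          qed
        qed
        have "q (x + y) \<le> p ((x + y) + (t + s) *\<^sub>R b') - (t + s) * d"
          using le[of "t+s" b' "x+y"] t s b' by simp
        also have "(x + y) + (t + s) *\<^sub>R b' = (x + t *\<^sub>R b) + (y + s *\<^sub>R c)" using b' by simp
        also have "p \<dots> \<le> p (x + t *\<^sub>R b) + p (y + s *\<^sub>R c)" by (rule sublinear_add[OF p])
        finally show "q (x + y) \<le> q x + q y + e" using t s by (simp add: algebra_simps)
      qed
    next
      fix c :: real and x assume c: "0 < c"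
      show "q (c *\<^sub>R x) \<le> c * q x"
      proof (rule field_le_epsilon)
        fix e :: real assume e: "0 < e"
        obtain t b where t: "0 \<le> t" "b \<in> B" "p (x + t *\<^sub>R b) - t * d < q x + e/c"
          using approx[of "e/c" x] e c by auto
        have "q (c *\<^sub>R x) \<le> p (c *\<^sub>R x + (c * t) *\<^sub>R b) - (c * t) * d" by (rule le) (use t c in auto)
        also have "c *\<^sub>R x + (c * t) *\<^sub>R b = c *\<^sub>R (x + t *\<^sub>R b)" by (simp add: scaleR_add_right)
        also have "p \<dots> = c * p (x + t *\<^sub>R b)" using p c by (simp add: sublinear_scale)
        also have "\<dots> - c * t * d = c * (p (x + t *\<^sub>R b) - t * d)" by (simp add: algebra_simps)
        also have "\<dots> \<le> c * (q x + e/c)" using t c by (intro mult_left_mono) auto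
        also have "\<dots> = c * q x + e" using c by (simp add: algebra_simps)
        finally show "q (c *\<^sub>R x) \<le> c * q x + e" .
      qed
    qed
    obtain b where "b \<in> B" using B by auto
    then show "q x \<le> p x" for x using le[of 0 b x] by simp
    show "q (- b) \<le> - d" if "b \<in> B" for b
      using le[of 1 b "- b"] that sublinear_zero[OF p] by simp
  qed
qed

text \<open>
  Zorn's lemma, applied downwards: the pointwise infimum of a chain of sublinear functionals below
  \<open>p\<close> is finite because each member is bounded below by \<open>- p (- x)\<close> at \<open>x\<close>, and the chain condition makes
  it subadditive.
\<close>

lemma sublinear_minimal:
  fixes p :: "'a::real_vector \<Rightarrow> real"
  assumes p: "sublinear p"
  obtains m where "sublinear m" "m \<le> p" "\<And>q. sublinear q \<Longrightarrow> q \<le> m \<Longrightarrow> q = m"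
proof -
  define A where "A = {q. sublinear q \<and> q \<le> p}"
  have "\<exists>m\<in>A. \<forall>a\<in>A. a \<le> m \<longrightarrow> a = m"
  proof (rule predicate_Zorn)
    show "partial_order_on A (relation_of (\<lambda>a b. b \<le> a) A)"
      by (auto simp: partial_order_on_def preorder_on_def relation_of_def refl_on_def trans_def antisym_def)
    fix C assume "C \<in> Chains (relation_of (\<lambda>a b. b \<le> a) A)"
    then have CA: "C \<subseteq> A" and ch: "\<And>a b. a \<in> C \<Longrightarrow> b \<in> C \<Longrightarrow> a \<le> b \<or> b \<le> a"
      by (auto simp: Chains_def relation_of_def)
    show "\<exists>u\<in>A. \<forall>a\<in>C. u \<le> a"
    proof (cases "C = {}")
      case True then show ?thesis using p by (auto simp: A_def)
    next
      case False
      define u where "u x = (INF q\<in>C. q x)" for x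
      have bd: "bdd_below ((\<lambda>q. q x) ` C)" for x
      proof (rule bdd_belowI2)
        fix q assume "q \<in> C"
        then have q: "sublinear q" "q \<le> p" using CA by (auto simp: A_def)
        show "- p (- x) \<le> q x" using sublinear_lower[OF q(1), of x] le_funD[OF q(2), of "- x"] by simp
      qed
      have low: "u x \<le> q x" if "q \<in> C" for q x
        unfolding u_def using bd that by (rule cINF_lower)
      have approx: "\<exists>q\<in>C. q x < u x + e" if "0 < e" for x and e :: real
      proof -
        have "(INF q\<in>C. q x) < u x + e" using that by (simp add: u_def)
        then show ?thesis using cInf_lessD[of "(\<lambda>q. q x) ` C"] False by auto
      qed
      have "sublinear u"
      proof (rule sublinearI)
        fix x y
        show "u (x + y) \<le> u x + u y"
        proof (rule field_le_epsilon)
          fix e :: real assume e: "0 < e"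
          obtain a where a: "a \<in> C" "a x < u x + e/2" using approx[of "e/2" x] e by auto
          obtain b where b: "b \<in> C" "b y < u y + e/2" using approx[of "e/2" y] e by auto
          obtain c where c: "c \<in> C" "c \<le> a" "c \<le> b" using ch[OF a(1) b(1)] a b by auto
          have "sublinear c" using c CA by (auto simp: A_def)
          then have "u (x + y) \<le> c x + c y" using low[OF c(1), of "x+y"] sublinear_add[of c x y] by simp
          then show "u (x + y) \<le> u x + u y + e" using a b le_funD[OF c(2), of x] le_funD[OF c(3), of y] by simp
        qed
      next
        fix c :: real and x assume c: "0 < c"
        show "u (c *\<^sub>R x) \<le> c * u x"
        proof (rule field_le_epsilon)
          fix e :: real assume e: "0 < e"
          obtain a where a: "a \<in> C" "a x < u x + e/c" using approx[of "e/c" x] e c by auto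
          then have "sublinear a" using CA by (auto simp: A_def)
          then have "u (c *\<^sub>R x) \<le> c * a x" using low[OF a(1), of "c *\<^sub>R x"] c by (simp add: sublinear_scale)
          also have "\<dots> \<le> c * (u x + e/c)" using a c by (intro mult_left_mono) auto
          also have "\<dots> = c * u x + e" using c by (simp add: algebra_simps)
          finally show "u (c *\<^sub>R x) \<le> c * u x + e" .
        qed
      qed
      moreover obtain q where "q \<in> C" using False by auto
      then have "u \<le> p" using low CA by (force simp: A_def le_fun_def intro: order_trans)
      ultimately show ?thesis using low by (auto simp: A_def le_fun_def)
    qed
  qed
  then obtain m where m: "m \<in> A" "\<And>a. a \<in> A \<Longrightarrow> a \<le> m \<Longrightarrow> a = m" by blast
  show ?thesis
  proof (rule that)
    show "sublinear m" "m \<le> p" using m by (auto simp: A_def)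
    show "q = m" if "sublinear q" "q \<le> m" for q
      by (rule m(2)) (use that m(1) in \<open>auto simp: A_def intro: order_trans\<close>)
  qed
qed

text \<open>
  A minimal sublinear functional \<open>m\<close> is linear: pushing it down in the direction \<open>- y\<close> alone
  cannot change it, so \<open>m (- y) \<le> - m y\<close>, and an odd sublinear functional is additive.  Hence it
  suffices to push \<open>p\<close> down along \<open>B\<close> once and to take a minimal functional below the result.
\<close>

lemma mazur_orlicz:
  fixes p :: "'a::real_vector \<Rightarrow> real"
  assumes p: "sublinear p" and B: "convex B" "B \<noteq> {}" and d: "\<And>b. b \<in> B \<Longrightarrow> d \<le> p b"
  obtains g where "linear g" "\<And>x. g x \<le> p x" "\<And>b. b \<in> B \<Longrightarrow> d \<le> g b"
proof -
  obtain q where q: "sublinear q" "\<And>x. q x \<le> p x" "\<And>b. b \<in> B \<Longrightarrow> q (- b) \<le> - d"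
    using sublinear_push_down[OF assms] by blast
  obtain m where m: "sublinear m" "m \<le> q" and min: "\<And>r. sublinear r \<Longrightarrow> r \<le> m \<Longrightarrow> r = m"
    using sublinear_minimal[OF q(1)] by blast
  have odd: "m (- y) = - m y" for y
  proof (rule antisym)
    obtain r where r: "sublinear r" "\<And>x. r x \<le> m x" "r (- y) \<le> - m y"
      using sublinear_push_down[OF m(1), of "{y}" "m y"] by auto
    have "r = m" by (rule min) (use r in \<open>auto simp: le_fun_def\<close>)
    then show "m (- y) \<le> - m y" using r by simp
    show "- m y \<le> m (- y)" using sublinear_lower[OF m(1), of y] by simp
  qed
  have "linear m"
  proof (rule linearI)
    show "m (x + y) = m x + m y" for x y
      using sublinear_add[OF m(1), of x y] sublinear_add[OF m(1), of "x + y" "- y"] odd[of y] by simp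
    show "m (c *\<^sub>R x) = c *\<^sub>R m x" for c x
    proof (cases "0 \<le> c")
      case True then show ?thesis using sublinear_scale[OF m(1)] by simp
    next
      case False
      then have "m (c *\<^sub>R x) = - m ((- c) *\<^sub>R x)" using odd[of "(- c) *\<^sub>R x"] by simp
      also have "\<dots> = c * m x" using sublinear_scale[OF m(1), of "- c" x] False by simp
      finally show ?thesis by simp
    qed
  qed
  moreover have "m x \<le> p x" for x using le_funD[OF m(2), of x] q(2)[of x] by simp
  moreover have "d \<le> m b" if "b \<in> B" for b
    using le_funD[OF m(2), of "- b"] q(3)[OF that] odd[of b] by simp
  ultimately show ?thesis by (rule that)
qed

text \<open>
  The Mazur--Orlicz theorem for the norm.  For a singleton \<open>B\<close> it yields norming functionals, and
  applied in a dual space it yields elements of the bidual.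
\<close>

lemma norm_separation:
  fixes B :: "'a::real_normed_vector set"
  assumes "convex B" "B \<noteq> {}" "\<And>b. b \<in> B \<Longrightarrow> d \<le> norm b"
  obtains f :: "'a \<Rightarrow>\<^sub>L real" where "norm f \<le> 1" "\<And>b. b \<in> B \<Longrightarrow> d \<le> blinfun_apply f b"
proof -
  have "sublinear (norm :: 'a \<Rightarrow> real)" by (rule sublinearI) (auto simp: norm_triangle_ineq)
  then obtain g where g: "linear g" "\<And>x. g x \<le> norm x" "\<And>b. b \<in> B \<Longrightarrow> d \<le> g b"
    using mazur_orlicz[of norm B d] assms by blast
  have abs: "norm (g x) \<le> norm x * 1" for x
    using g(2)[of x] g(2)[of "- x"] linear_neg[OF g(1), of x] by auto
  have bl: "bounded_linear g" using g(1) abs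
    by (auto intro!: bounded_linear.intro bounded_linear_axioms.intro exI[of _ 1])
  show ?thesis
  proof (rule that[of "Blinfun g"])
    show "norm (Blinfun g) \<le> 1"
      by (rule norm_blinfun_bound) (use bl abs in \<open>auto simp: bounded_linear_Blinfun_apply\<close>)
    show "d \<le> blinfun_apply (Blinfun g) b" if "b \<in> B" for b
      using that g bl by (simp add: bounded_linear_Blinfun_apply)
  qed
qed

section \<open>The weak topology and the bidual\<close>

text \<open>
  The translate \<open>C - x\<close> stays away from the origin by a positive distance.
\<close>

lemma closed_convex_separation:
  fixes C :: "'a::real_normed_vector set"
  assumes "closed C" "convex C" "C \<noteq> {}" "x \<notin> C"
  obtains f :: "'a \<Rightarrow>\<^sub>L real" and d where "0 < d" "\<And>a. a \<in> C \<Longrightarrow> blinfun_apply f x + d \<le> blinfun_apply f a"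
proof -
  obtain d where d: "0 < d" "ball x d \<inter> C = {}"
    using assms(1,4) by (metis ComplI disjoint_eq_subset_Compl open_Compl open_contains_ball)
  define B where "B = (+) (- x) ` C"
  have "convex B" "B \<noteq> {}" using assms by (auto simp: B_def)
  moreover have "d \<le> norm b" if b: "b \<in> B" for b
  proof -
    obtain a where a: "a \<in> C" "b = - x + a" using b unfolding B_def by blast
    then have "a \<notin> ball x d" using d by auto
    then show ?thesis using a by (simp add: dist_norm norm_minus_commute)
  qed
  ultimately obtain f :: "'a \<Rightarrow>\<^sub>L real" where f: "\<And>b. b \<in> B \<Longrightarrow> d \<le> blinfun_apply f b"
    using norm_separation[of B d] by blast
  have "blinfun_apply f x + d \<le> blinfun_apply f a" if "a \<in> C" for a
    using f[of "- x + a"] that by (auto simp: B_def blinfun.diff_right)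
  with d(1) show ?thesis by (rule that)
qed

lemma openin_weak_vimage:
  fixes f :: "'a::real_normed_vector \<Rightarrow> real"
  shows "bounded_linear f \<Longrightarrow> open U \<Longrightarrow> openin weak_topology (f -` U)"
  unfolding weak_topology_def by (rule topology_generated_by_Basis) blast

lemma topspace_weak_topology: "topspace (weak_topology :: 'a::real_normed_vector topology) = UNIV"
proof -
  have "openin weak_topology ((\<lambda>_::'a. 0::real) -` UNIV)" by (rule openin_weak_vimage) auto
  then show ?thesis using openin_subset by fastforce
qed

text \<open>
  Mazur's theorem: a point outside \<open>C\<close> has a weakly open half-space around it that misses \<open>C\<close>.
\<close>

lemma closedin_weak_closed_convex:
  fixes C :: "'a::real_normed_vector set"
  assumes "closed C" "convex C"
  shows "closedin weak_topology C"
proof (cases "C = {}")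
  case False
  have "openin weak_topology (- C)"
  proof (subst openin_subopen, safe)
    fix x assume x: "x \<notin> C"
    obtain f :: "'a \<Rightarrow>\<^sub>L real" and d
      where f: "0 < d" "\<And>a. a \<in> C \<Longrightarrow> blinfun_apply f x + d \<le> blinfun_apply f a"
      using closed_convex_separation[OF assms False x] by blast
    have "openin weak_topology (blinfun_apply f -` {..< blinfun_apply f x + d})"
      by (rule openin_weak_vimage) (auto intro: blinfun.bounded_linear_right)
    moreover have "blinfun_apply f -` {..< blinfun_apply f x + d} \<subseteq> - C" using f(2) by force
    ultimately show "\<exists>T. openin weak_topology T \<and> x \<in> T \<and> T \<subseteq> - C" using f(1) by auto
  qed
  then show ?thesis by (simp add: closedin_def topspace_weak_topology Compl_eq_Diff_UNIV)
qed simp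

text \<open>
  The canonical embedding into the bidual, with elements of the bidual regarded as mere functions:
  their pointwise topology then is the product topology, for which Tychonoff's theorem is
  available.
\<close>

definition evaluation :: "'a::real_normed_vector \<Rightarrow> ('a \<Rightarrow>\<^sub>L real) \<Rightarrow> real" where
  "evaluation x f = blinfun_apply f x"

text \<open>
  The weak topology is the one induced from the product topology by the evaluation map.
\<close>

lemma openin_weak_topologyD:
  assumes "openin weak_topology (W :: 'a::real_normed_vector set)"
  shows "\<exists>V. open V \<and> evaluation -` V = W"
proof -
  have "generate_topology_on {f -` U | (f :: 'a \<Rightarrow> real) U. bounded_linear f \<and> open U} W"
    using assms unfolding weak_topology_def by (rule openin_topology_generated_by)
  then show ?thesis
  proof (induction rule: generate_topology_on.induct)
    case Empty then show ?case by (intro exI[of _ "{}"]) auto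
  next
    case (Int a b)
    then obtain V V' where "open V" "evaluation -` V = a" "open V'" "evaluation -` V' = b" by blast
    then show ?case by (intro exI[of _ "V \<inter> V'"]) (simp add: open_Int)
  next
    case (UN K)
    then have "\<forall>k\<in>K. \<exists>V. open V \<and> evaluation -` V = k" by blast
    then obtain V where V: "\<forall>k\<in>K. open (V k) \<and> evaluation -` V k = k" by (rule bchoice[THEN exE])
    have "evaluation -` (\<Union>k\<in>K. V k) = (\<Union>k\<in>K. k)"
      unfolding vimage_UN using V by (intro SUP_cong[OF refl]) (drule bspec, assumption, erule conjunct2)
    moreover have "open (\<Union>k\<in>K. V k)" using V by (intro open_UN ballI) (drule bspec, assumption, erule conjunct1)
    ultimately show ?case by (intro exI[of _ "\<Union>k\<in>K. V k"]) simp
  next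
    case (Basis s)
    then obtain f :: "'a \<Rightarrow> real" and U where f: "s = f -` U" "bounded_linear f" "open U" by blast
    have "open ((\<lambda>F :: ('a \<Rightarrow>\<^sub>L real) \<Rightarrow> real. F (Blinfun f)) -` U)"
      using f(3) by (intro open_vimage) auto
    moreover have "evaluation -` ((\<lambda>F. F (Blinfun f)) -` U) = s"
      using f by (auto simp: evaluation_def bounded_linear_Blinfun_apply)
    ultimately show ?case by blast
  qed
qed

lemma compactin_weak_topologyI:
  assumes "compact (evaluation ` (A :: 'a::real_normed_vector set))"
  shows "compactin weak_topology A"
  unfolding compactin_def
proof (intro conjI allI impI)
  fix \<U> assume U: "(\<forall>W\<in>\<U>. openin weak_topology W) \<and> A \<subseteq> \<Union>\<U>"
  have "\<forall>W\<in>\<U>. \<exists>V. open V \<and> evaluation -` V = W"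
    using U by (simp add: openin_weak_topologyD)
  then obtain V where V: "\<forall>W\<in>\<U>. open (V W) \<and> evaluation -` V W = W"
    by (rule bchoice[THEN exE])
  have "evaluation ` A \<subseteq> (\<Union>W\<in>\<U>. V W)"
  proof
    fix F assume "F \<in> evaluation ` A"
    then obtain x W where "F = evaluation x" "x \<in> W" "W \<in> \<U>" using U by blast
    then show "F \<in> (\<Union>W\<in>\<U>. V W)" using V by (metis UN_I vimageE)
  qed
  then obtain \<F> where F: "\<F> \<subseteq> \<U>" "finite \<F>" "evaluation ` A \<subseteq> (\<Union>W\<in>\<F>. V W)"
    using compactE_image[OF assms, of \<U> V] V by (metis (no_types))
  have "A \<subseteq> \<Union>\<F>"
  proof
    fix x assume "x \<in> A"
    then obtain W where W: "W \<in> \<F>" "evaluation x \<in> V W" using F(3) by blast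
    then have "x \<in> evaluation -` V W" by simp
    then show "x \<in> \<Union>\<F>" using W F(1) V by (metis UnionI subsetD)
  qed
  with F show "\<exists>\<F>. finite \<F> \<and> \<F> \<subseteq> \<U> \<and> A \<subseteq> \<Union>\<F>" by blast
qed (simp add: topspace_weak_topology)

text \<open>
  The core of the Banach--Alaoglu theorem: by Tychonoff's theorem, a product of compact intervals is
  compact.
\<close>

lemma compact_bounded_functionals:
  "compact {F :: ('a::real_normed_vector \<Rightarrow>\<^sub>L real) \<Rightarrow> real. \<forall>f. \<bar>F f\<bar> \<le> norm f}"
proof -
  have "compactin (product_topology (\<lambda>_. euclidean) UNIV)
      (PiE UNIV (\<lambda>f :: 'a \<Rightarrow>\<^sub>L real. {- norm f .. norm f}))"
    by (subst compactin_PiE) simp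
  moreover have "PiE UNIV (\<lambda>f :: 'a \<Rightarrow>\<^sub>L real. {- norm f .. norm f}) = {F. \<forall>f. \<bar>F f\<bar> \<le> norm f}"
    by (simp add: PiE_UNIV_domain abs_le_iff set_eq_iff Pi_iff minus_le_iff conj_commute)
  ultimately show ?thesis by (simp add: euclidean_product_topology)
qed

lemma closure_pointwise_approx:
  fixes F :: "'b \<Rightarrow> real"
  assumes "F \<in> closure X" "finite S" "0 < e"
  obtains G where "G \<in> X" "\<And>f. f \<in> S \<Longrightarrow> \<bar>G f - F f\<bar> < e"
proof -
  define V where "V = (\<Inter>f\<in>S. (\<lambda>G :: 'b \<Rightarrow> real. G f) -` ball (F f) e)"
  have "open V" unfolding V_def using assms(2)
    by (intro open_INT ballI open_vimage) auto
  moreover have "F \<in> V" using assms(3) by (simp add: V_def)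
  ultimately obtain G where "G \<in> X" "G \<in> V"
    using assms(1) by (meson closure_iff_nhds_not_empty disjoint_iff subset_refl)
  then show ?thesis using that by (auto simp: V_def dist_real_def abs_minus_commute)
qed

text \<open>
  The image of \<open>A\<close> under evaluation lies in a compact set, so it cannot be closed; take \<open>F\<close> in its
  closure but not in it.  Being a pointwise limit of linear maps, \<open>F\<close> is linear.  If \<open>F\<close> were at
  distance 0 from the evaluations in the bidual norm, points evaluating to better and
  better approximations of \<open>F\<close> would be a Cauchy sequence, whose limit \<open>y\<close> evaluates to \<open>F\<close>; as \<open>F\<close> is a weak-star limit of points of the
  weakly closed set \<open>A\<close>, the point \<open>y\<close> would belong to \<open>A\<close>.
\<close>

lemma non_weakly_compact_limit:
  fixes A :: "'a::banach set"
  assumes A: "closed A" "convex A" "A \<subseteq> cball 0 1" and nc: "\<not> compactin weak_topology A"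
  shows "\<exists>F :: ('a \<Rightarrow>\<^sub>L real) \<Rightarrow> real. \<exists>d. linear F \<and> 0 < d
    \<and> (\<forall>S e. finite S \<longrightarrow> 0 < e \<longrightarrow> (\<exists>x\<in>A. \<forall>f\<in>S. \<bar>blinfun_apply f x - F f\<bar> < e))
    \<and> (\<forall>x c. (\<forall>f. \<bar>F f - blinfun_apply f x\<bar> \<le> c * norm f) \<longrightarrow> d \<le> c)"
proof -
  have "A \<noteq> {}" using nc by auto
  let ?K = "{F :: ('a \<Rightarrow>\<^sub>L real) \<Rightarrow> real. \<forall>f. \<bar>F f\<bar> \<le> norm f}"
  have "evaluation ` A \<subseteq> ?K"
  proof clarify
    fix x and f :: "'a \<Rightarrow>\<^sub>L real" assume "x \<in> A"
    then have "norm x \<le> 1" using A(3) by auto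
    then have "norm f * norm x \<le> norm f" by (simp add: mult_left_le)
    then show "\<bar>evaluation x f\<bar> \<le> norm f"
      using norm_blinfun[of f x] by (simp add: evaluation_def)
  qed
  then have "\<not> closed (evaluation ` A)"
    using nc compactin_weak_topologyI compact_Int_closed[OF compact_bounded_functionals, of "evaluation ` A"]
    by (auto simp: Int_absorb1)
  then obtain F where F: "F \<in> closure (evaluation ` A)" "F \<notin> evaluation ` A"
    by (metis closure_subset closure_eq subsetI subset_antisym)
  have approx: "\<exists>x\<in>A. \<forall>f\<in>S. \<bar>blinfun_apply f x - F f\<bar> < e" if S: "finite S" "0 < e" for S e
  proof -
    obtain G where G: "G \<in> evaluation ` A" "\<And>f. f \<in> S \<Longrightarrow> \<bar>G f - F f\<bar> < e"
      using closure_pointwise_approx[OF F(1) S] by blast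
    then obtain x where "x \<in> A" "G = evaluation x" by blast
    with G(2) show ?thesis unfolding evaluation_def by blast
  qed
  have lin: "linear F"
  proof (rule linearI)
    fix f g
    show "F (f + g) = F f + F g"
    proof (rule ccontr)
      assume ne: "F (f + g) \<noteq> F f + F g"
      define e where "e = \<bar>F (f + g) - (F f + F g)\<bar> / 3"
      have "0 < e" using ne by (simp add: e_def)
      then obtain x where x: "\<forall>h\<in>{f, g, f + g}. \<bar>blinfun_apply h x - F h\<bar> < e"
        using approx[of "{f, g, f + g}" e] by auto
      then have "\<bar>F (f + g) - (F f + F g)\<bar> < 3 * e"
        by (simp add: blinfun.add_left) (smt (verit))
      then show False by (simp add: e_def)
    qed
  next
    fix c f
    have "F (c *\<^sub>R f) = c * F f"
    proof (rule ccontr)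
      assume ne: "F (c *\<^sub>R f) \<noteq> c * F f"
      define e where "e = \<bar>F (c *\<^sub>R f) - c * F f\<bar> / (1 + \<bar>c\<bar>)"
      have "0 < e" using ne by (simp add: e_def add_pos_nonneg)
      then obtain x where x: "\<forall>h\<in>{f, c *\<^sub>R f}. \<bar>blinfun_apply h x - F h\<bar> < e"
        using approx[of "{f, c *\<^sub>R f}" e] by auto
      have "\<bar>c * blinfun_apply f x - c * F f\<bar> = \<bar>c\<bar> * \<bar>blinfun_apply f x - F f\<bar>"
        by (simp add: abs_mult right_diff_distrib[symmetric])
      also have "\<dots> \<le> \<bar>c\<bar> * e" using x by (intro mult_left_mono) auto
      finally have "\<bar>F (c *\<^sub>R f) - c * F f\<bar> < e + \<bar>c\<bar> * e"
        using x by (simp add: blinfun.scaleR_left) linarith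
      also have "\<dots> = \<bar>F (c *\<^sub>R f) - c * F f\<bar>" by (simp add: e_def add_divide_distrib[symmetric] distrib_left[symmetric] add_nonneg_eq_0_iff field_simps)
      finally show False by simp
    qed
    then show "F (c *\<^sub>R f) = c *\<^sub>R F f" by simp
  qed
  have "\<exists>d>0. \<forall>x c. (\<forall>f. \<bar>F f - blinfun_apply f x\<bar> \<le> c * norm f) \<longrightarrow> d \<le> c"
  proof (rule ccontr)
    assume "\<not> ?thesis"
    then have "\<exists>x c. c < inverse (real (Suc n)) \<and> (\<forall>f. \<bar>F f - blinfun_apply f x\<bar> \<le> c * norm f)" for n
      by (metis inverse_positive_iff_positive not_le of_nat_0_less_iff zero_less_Suc)
    then obtain x c where xc: "\<And>n. c n < inverse (real (Suc n))"
        "\<And>n f. \<bar>F f - blinfun_apply f (x n)\<bar> \<le> c n * norm f"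
      by metis
    have x: "\<bar>F f - blinfun_apply f (x n)\<bar> \<le> inverse (real (Suc n)) * norm f" for n f
      using xc(2)[of f n] xc(1)[of n] by (meson less_imp_le mult_right_mono norm_ge_zero order_trans)
    have diff: "norm (x m - x n) \<le> inverse (real (Suc m)) + inverse (real (Suc n))" for m n
    proof -
      obtain f :: "'a \<Rightarrow>\<^sub>L real" where f: "norm f \<le> 1" "norm (x m - x n) \<le> blinfun_apply f (x m - x n)"
        using norm_separation[of "{x m - x n}" "norm (x m - x n)"] by auto
      have *: "\<bar>F f - blinfun_apply f (x k)\<bar> \<le> inverse (real (Suc k))" for k
        using x[of f k] f(1) by (smt (verit) inverse_nonnegative_iff_nonnegative mult_left_le of_nat_0_le_iff)
      show ?thesis using f(2) *[of m] *[of n] by (simp add: blinfun.diff_right)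
    qed
    have inv0: "(\<lambda>n. inverse (real (Suc n))) \<longlonglongrightarrow> 0" by (rule LIMSEQ_inverse_real_of_nat)
    have "Cauchy x"
    proof (rule metric_CauchyI)
      fix e :: real assume "0 < e"
      then obtain N where N: "\<And>n. n \<ge> N \<Longrightarrow> inverse (real (Suc n)) < e/2"
        using order_tendstoD(2)[OF inv0, of "e/2"] by (auto simp: eventually_sequentially)
      then show "\<exists>M. \<forall>m\<ge>M. \<forall>n\<ge>M. dist (x m) (x n) < e"
      proof (intro exI[of _ N] allI impI)
        fix m n assume "N \<le> m" "N \<le> n"
        then show "dist (x m) (x n) < e" using diff[of m n] N[of m] N[of n] by (simp add: dist_norm)
      qed
    qed
    then obtain y where y: "x \<longlonglongrightarrow> y" using Cauchy_convergent convergent_def by blast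
    have Fy: "F f = blinfun_apply f y" for f
    proof (rule LIMSEQ_unique)
      show "(\<lambda>n. blinfun_apply f (x n)) \<longlonglongrightarrow> blinfun_apply f y" using y by (intro tendsto_intros)
      have "(\<lambda>n. inverse (real (Suc n)) * norm f) \<longlonglongrightarrow> 0" using inv0 by (rule tendsto_mult_left_zero)
      then have "(\<lambda>n. blinfun_apply f (x n) - F f) \<longlonglongrightarrow> 0"
        by (rule Lim_null_comparison[rotated]) (use x in \<open>auto simp: abs_minus_commute\<close>)
      then show "(\<lambda>n. blinfun_apply f (x n)) \<longlonglongrightarrow> F f" by (simp add: LIM_zero_iff)
    qed
    have "y \<in> A"
    proof (rule ccontr)
      assume "y \<notin> A"
      then obtain f :: "'a \<Rightarrow>\<^sub>L real" and d
        where f: "0 < d" "\<And>a. a \<in> A \<Longrightarrow> blinfun_apply f y + d \<le> blinfun_apply f a"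
        using closed_convex_separation[OF A(1,2) \<open>A \<noteq> {}\<close>] by blast
      then obtain a where "a \<in> A" "\<bar>blinfun_apply f a - F f\<bar> < d" using approx[of "{f}" d] by auto
      then show False using f(2)[of a] Fy[of f] by simp
    qed
    moreover have "F = evaluation y" using Fy by (auto simp: evaluation_def)
    ultimately show False using F(2) by blast
  qed
  then show ?thesis using lin approx by blast
qed

section \<open>Sequences of James type\<close>

text \<open>
  Induction on \<open>S\<close>.  If the common kernel of the other functionals contains a vector \<open>w\<close> with
  \<open>G s w \<noteq> 0\<close>, then it is spanned by \<open>w\<close> and the common kernel of all functionals, so it
  suffices to subtract from \<open>F\<close> the multiple of \<open>G s\<close> which makes it vanish at \<open>w\<close>.
\<close>

lemma functional_in_span:
  fixes G :: "'i \<Rightarrow> 'v::real_vector \<Rightarrow> real"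
  assumes "finite S" "\<And>s. linear (G s)" "linear F"
    and "\<And>v. (\<And>s. s \<in> S \<Longrightarrow> G s v = 0) \<Longrightarrow> F v = 0"
  shows "\<exists>a. \<forall>v. F v = (\<Sum>s\<in>S. a s * G s v)"
  using assms(1,3,4)
proof (induction S arbitrary: F rule: finite_induct)
  case empty
  then show ?case by simp
next
  case (insert s S)
  show ?case
  proof (cases "\<exists>w. (\<forall>r\<in>S. G r w = 0) \<and> G s w \<noteq> 0")
    case True
    then obtain w where w: "\<And>r. r \<in> S \<Longrightarrow> G r w = 0" "G s w \<noteq> 0" by blast
    define b where "b = F w / G s w"
    define F' where "F' v = F v - b * G s v" for v
    have lin: "linear F'" unfolding F'_def
      using linear_compose_sub[OF insert.prems(1) linear_compose_scale_right[OF assms(2)[of s], of b]]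
      by simp
    have "F' v = 0" if v: "\<And>r. r \<in> S \<Longrightarrow> G r v = 0" for v
    proof -
      define u where "u = v - (G s v / G s w) *\<^sub>R w"
      have "G r u = 0" if "r \<in> insert s S" for r
        using that v w by (auto simp: u_def linear_diff[OF assms(2)] linear_scale[OF assms(2)])
      then have "F u = 0" by (rule insert.prems(2))
      then show ?thesis
        using w(2) by (simp add: u_def F'_def b_def linear_diff[OF insert.prems(1)]
            linear_scale[OF insert.prems(1)])
    qed
    then obtain a where a: "\<forall>v. F' v = (\<Sum>r\<in>S. a r * G r v)"
      using insert.IH[OF lin] by blast
    have "F v = (\<Sum>r\<in>insert s S. (a(s := b)) r * G r v)" for v
    proof -
      have "(\<Sum>r\<in>S. (a(s := b)) r * G r v) = (\<Sum>r\<in>S. a r * G r v)"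
        by (rule sum.cong) (use insert.hyps in auto)
      then show ?thesis using a insert.hyps by (simp add: F'_def algebra_simps)
    qed
    then show ?thesis by blast
  next
    case False
    have "F v = 0" if v: "\<And>r. r \<in> S \<Longrightarrow> G r v = 0" for v
      by (rule insert.prems(2)) (use False v in auto)
    then obtain a where a: "\<forall>v. F v = (\<Sum>r\<in>S. a r * G r v)"
      using insert.IH[OF insert.prems(1)] by blast
    have "F v = (\<Sum>r\<in>insert s S. (a(s := 0)) r * G r v)" for v
    proof -
      have "(\<Sum>r\<in>S. (a(s := 0)) r * G r v) = (\<Sum>r\<in>S. a r * G r v)"
        by (rule sum.cong) (use insert.hyps in auto)
      then show ?thesis using a insert.hyps by simp
    qed
    then show ?thesis by blast
  qed
qed

lemma evaluation_if_zero_on_annihilator: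
  fixes F :: "('a::real_normed_vector \<Rightarrow>\<^sub>L real) \<Rightarrow> real"
  assumes "finite S" "linear F"
    and "\<And>f. (\<And>x. x \<in> S \<Longrightarrow> blinfun_apply f x = 0) \<Longrightarrow> F f = 0"
  obtains y where "\<And>f. F f = blinfun_apply f y"
proof -
  have "linear (\<lambda>f :: 'a \<Rightarrow>\<^sub>L real. blinfun_apply f x)" for x
    by (intro bounded_linear.linear blinfun.bounded_linear_left)
  then obtain a where a: "\<forall>f. F f = (\<Sum>x\<in>S. a x * blinfun_apply f x)"
    using functional_in_span[of S "\<lambda>x f. blinfun_apply f x" F] assms by blast
  then have "F f = blinfun_apply f (\<Sum>x\<in>S. a x *\<^sub>R x)" for f
    by (simp add: blinfun.sum_right blinfun.scaleR_right)
  then show ?thesis by (rule that)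
qed

text \<open>
  Consider the affine set \<open>B\<close> of all \<open>f\<close> with \<open>F f = \<theta>\<close> that annihilate \<open>S\<close>; it is nonempty, as otherwise \<open>F\<close> itself would be an evaluation.  If it missed the unit
  ball, some \<open>\<Gamma>\<close> in the unit ball of the bidual would be at least 1 on \<open>B\<close>.  Bounded below on an affine
  set, \<open>\<Gamma>\<close> must be constant on it, so it is a multiple \<open>b F\<close> plus evaluation at some point,
  where \<open>b \<ge> 1 / \<theta>\<close>.  Dividing by \<open>b\<close> exhibits a point at distance at most \<open>\<theta> < d\<close> from \<open>F\<close>.
\<close>

lemma helly:
  fixes F :: "('a::real_normed_vector \<Rightarrow>\<^sub>L real) \<Rightarrow> real"
  assumes F: "linear F" and \<theta>: "0 < \<theta>" "\<theta> < d"
    and dist: "\<forall>x c. (\<forall>f. \<bar>F f - blinfun_apply f x\<bar> \<le> c * norm f) \<longrightarrow> d \<le> c"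
    and S: "finite S"
  shows "\<exists>f. norm f \<le> 1 \<and> F f = \<theta> \<and> (\<forall>x\<in>S. blinfun_apply f x = 0)"
proof (rule ccontr)
  assume no: "\<not> ?thesis"
  define B where "B = {f. F f = \<theta> \<and> (\<forall>x\<in>S. blinfun_apply f x = 0)}"
  have B1: "1 \<le> norm f" if "f \<in> B" for f
    using that no by (force simp: B_def)
  have "convex B"
  proof (rule convexI)
    fix f g and u v :: real assume "f \<in> B" "g \<in> B" "u + v = 1"
    moreover from this have "u * \<theta> + v * \<theta> = \<theta>" by (metis distrib_right mult_1)
    ultimately show "u *\<^sub>R f + v *\<^sub>R g \<in> B"
      by (simp add: B_def linear_add[OF F] linear_scale[OF F] blinfun.add_left blinfun.scaleR_left)
  qed
  moreover have "B \<noteq> {}"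
  proof
    assume empty: "B = {}"
    have "F f = 0" if "\<And>x. x \<in> S \<Longrightarrow> blinfun_apply f x = 0" for f
    proof (rule ccontr)
      assume "F f \<noteq> 0"
      then have "(\<theta> / F f) *\<^sub>R f \<in> B"
        using that by (simp add: B_def linear_scale[OF F] blinfun.scaleR_left)
      then show False using empty by simp
    qed
    then obtain y where "\<And>f. F f = blinfun_apply f y"
      using evaluation_if_zero_on_annihilator[OF S F] by blast
    then show False using dist[rule_format, of y 0] \<theta> by simp
  qed
  ultimately obtain \<Gamma> :: "('a \<Rightarrow>\<^sub>L real) \<Rightarrow>\<^sub>L real"
    where \<Gamma>: "norm \<Gamma> \<le> 1" "\<And>f. f \<in> B \<Longrightarrow> 1 \<le> blinfun_apply \<Gamma> f"
    using norm_separation[of B 1] B1 by blast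
  obtain f0 where f0: "f0 \<in> B" using \<open>B \<noteq> {}\<close> by blast
  define b where "b = blinfun_apply \<Gamma> f0 / \<theta>"
  have b: "1 / \<theta> \<le> b" using \<Gamma>(2)[OF f0] \<theta> by (simp add: b_def divide_right_mono)
  then have bpos: "0 < b" using \<theta> by (meson divide_pos_pos less_le_trans zero_less_one)
  have ker: "blinfun_apply \<Gamma> h = 0" if h: "F h = 0" "\<And>x. x \<in> S \<Longrightarrow> blinfun_apply h x = 0" for h
  proof (rule ccontr)
    assume ne: "blinfun_apply \<Gamma> h \<noteq> 0"
    \<comment> \<open>The point of the line \<open>f0 + t h\<close> in \<open>B\<close> at which \<open>\<Gamma>\<close> vanishes.\<close>
    define t where "t = - blinfun_apply \<Gamma> f0 / blinfun_apply \<Gamma> h"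
    have "f0 + t *\<^sub>R h \<in> B"
      using f0 h by (simp add: B_def linear_add[OF F] linear_scale[OF F] blinfun.add_left blinfun.scaleR_left)
    then have "1 \<le> blinfun_apply \<Gamma> (f0 + t *\<^sub>R h)" by (rule \<Gamma>(2))
    also have "\<dots> = blinfun_apply \<Gamma> f0 + t * blinfun_apply \<Gamma> h"
      by (simp only: blinfun.add_right blinfun.scaleR_right real_scaleR_def)
    also have "\<dots> = 0" using ne by (simp add: t_def)
    finally show False by simp
  qed
  define H where "H f = blinfun_apply \<Gamma> f - b * F f" for f
  have linH: "linear H" unfolding H_def
    using linear_compose_sub[OF bounded_linear.linear[OF blinfun.bounded_linear_right[of \<Gamma>]]
        linear_compose_scale_right[OF F, of b]] by simp
  have "H f = 0" if f: "\<And>x. x \<in> S \<Longrightarrow> blinfun_apply f x = 0" for f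
  proof -
    have "blinfun_apply \<Gamma> (f - (F f / \<theta>) *\<^sub>R f0) = 0"
      by (rule ker) (use f f0 \<theta> in \<open>auto simp: B_def linear_diff[OF F] linear_scale[OF F]
            blinfun.diff_left blinfun.scaleR_left\<close>)
    then show ?thesis by (simp add: H_def b_def blinfun.diff_right blinfun.scaleR_right)
  qed
  then obtain y where y: "\<And>f. H f = blinfun_apply f y"
    using evaluation_if_zero_on_annihilator[OF S linH] by blast
  have "\<bar>F f - blinfun_apply f ((- 1 / b) *\<^sub>R y)\<bar> \<le> \<theta> * norm f" for f
  proof -
    have "F f - blinfun_apply f ((- 1 / b) *\<^sub>R y) = blinfun_apply \<Gamma> f / b"
      using bpos y[of f] by (simp add: blinfun.scaleR_right blinfun.minus_right H_def field_simps)
    moreover have "\<bar>blinfun_apply \<Gamma> f\<bar> \<le> norm f"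
      using norm_blinfun[of \<Gamma> f] \<Gamma>(1) mult_right_mono[OF \<Gamma>(1) norm_ge_zero[of f]] by simp
    then have "\<bar>blinfun_apply \<Gamma> f / b\<bar> \<le> norm f / b" using bpos by (simp add: divide_right_mono)
    moreover have "norm f / b \<le> \<theta> * norm f"
    proof -
      have "1 \<le> \<theta> * b" using b \<theta> by (simp add: field_simps)
      then have "1 * norm f \<le> (\<theta> * b) * norm f" by (intro mult_right_mono) auto
      then show ?thesis using bpos by (simp add: field_simps)
    qed
    ultimately show ?thesis by linarith
  qed
  then have "d \<le> \<theta>" by (intro dist[rule_format])
  then show False using \<theta> by simp
qed

text \<open>
  The recursion alternates the two approximation properties of \<open>F\<close>: the new functional is chosen by
  Helly's theorem against the earlier vectors, and then the new vector in \<open>A\<close> imitates \<open>F\<close> on the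
  functionals found so far, all of which satisfy \<open>F f = 1\<close>.
\<close>

lemma james_sequence:
  fixes F :: "('a::real_normed_vector \<Rightarrow>\<^sub>L real) \<Rightarrow> real" and \<epsilon> :: "nat \<Rightarrow> real"
  assumes F: "linear F" and d: "0 < d"
    and approx: "\<forall>S e. finite S \<longrightarrow> 0 < e \<longrightarrow> (\<exists>x\<in>A. \<forall>f\<in>S. \<bar>blinfun_apply f x - F f\<bar> < e)"
    and dist: "\<forall>x c. (\<forall>f. \<bar>F f - blinfun_apply f x\<bar> \<le> c * norm f) \<longrightarrow> d \<le> c"
    and \<epsilon>: "\<And>n. 0 < \<epsilon> n"
  obtains C x f where "0 < C" "\<And>n. x n \<in> A" "\<And>n. norm (f n) \<le> C"
    "\<And>n k. k < n \<Longrightarrow> blinfun_apply (f n) (x k) = 0"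
    "\<And>n k. n \<le> k \<Longrightarrow> \<bar>blinfun_apply (f n) (x k) - 1\<bar> < \<epsilon> k"
proof -
  \<comment> \<open>The previous lemma with \<open>\<theta> = d / 2\<close>, rescaled so that \<open>F f = 1\<close>.\<close>
  define C where "C = 2 / d"
  have C: "0 < C" using d by (simp add: C_def)
  have helly': "\<exists>f. norm f \<le> C \<and> F f = 1 \<and> (\<forall>x\<in>S. blinfun_apply f x = 0)"
    if S: "finite S" for S
  proof -
    have "\<exists>f. norm f \<le> 1 \<and> F f = d / 2 \<and> (\<forall>x\<in>S. blinfun_apply f x = 0)"
      using helly[OF F _ _ dist S, of "d / 2"] d by simp
    then obtain f where f: "norm f \<le> 1" "F f = d / 2" "\<forall>x\<in>S. blinfun_apply f x = 0" by blast
    show ?thesis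
    proof (intro exI[of _ "C *\<^sub>R f"] conjI ballI)
      show "norm (C *\<^sub>R f) \<le> C" using f(1) C by (simp add: mult_left_le)
    qed (use f C d in \<open>auto simp: linear_scale[OF F] blinfun.scaleR_left C_def\<close>)
  qed
  \<comment> \<open>Condition on the \<open>n\<close>-th pair of a functional and a vector, given the earlier pairs \<open>z\<close>.\<close>
  define P :: "(nat \<Rightarrow> ('a \<Rightarrow>\<^sub>L real) \<times> 'a) \<Rightarrow> nat \<Rightarrow> ('a \<Rightarrow>\<^sub>L real) \<times> 'a \<Rightarrow> bool" where
    "P z n r \<longleftrightarrow> norm (fst r) \<le> C \<and> F (fst r) = 1 \<and> snd r \<in> A
      \<and> (\<forall>j<n. blinfun_apply (fst r) (snd (z j)) = 0)
      \<and> \<bar>blinfun_apply (fst r) (snd r) - 1\<bar> < \<epsilon> n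
      \<and> (\<forall>j<n. \<bar>blinfun_apply (fst (z j)) (snd r) - 1\<bar> < \<epsilon> n)" for z n r
  have "\<exists>z. \<forall>n. P z n (z n)"
  proof (rule dependent_wellorder_choice)
    fix r n and z w :: "nat \<Rightarrow> ('a \<Rightarrow>\<^sub>L real) \<times> 'a" assume "\<And>j. j < n \<Longrightarrow> z j = w j"
    then show "P z n r = P w n r" by (simp add: P_def)
  next
    fix n and z :: "nat \<Rightarrow> ('a \<Rightarrow>\<^sub>L real) \<times> 'a" assume IH: "\<And>j. j < n \<Longrightarrow> P z j (z j)"
    obtain f where f: "norm f \<le> C" "F f = 1" "\<forall>x\<in>(\<lambda>j. snd (z j)) ` {..<n}. blinfun_apply f x = 0"
      using helly'[of "(\<lambda>j. snd (z j)) ` {..<n}"] by auto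
    obtain x where x: "x \<in> A"
        "\<forall>g\<in>insert f ((\<lambda>j. fst (z j)) ` {..<n}). \<bar>blinfun_apply g x - F g\<bar> < \<epsilon> n"
      using approx[rule_format, of "insert f ((\<lambda>j. fst (z j)) ` {..<n})" "\<epsilon> n"] \<epsilon> by auto
    have "F (fst (z j)) = 1" if "j < n" for j using IH[OF that] by (simp add: P_def)
    then have "P z n (f, x)" using f x by (auto simp: P_def)
    then show "\<exists>r. P z n r" ..
  qed
  then obtain z where z: "\<And>n. P z n (z n)" by blast
  show ?thesis
  proof (rule that[of C "\<lambda>n. snd (z n)" "\<lambda>n. fst (z n)"])
    show "\<bar>blinfun_apply (fst (z n)) (snd (z k)) - 1\<bar> < \<epsilon> k" if "n \<le> k" for n k
      using z[of k] that by (cases "n = k") (auto simp: P_def)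
  qed (use z C in \<open>auto simp: P_def\<close>)
qed

section \<open>The Banach space \<open>\<ell>\<^sub>1\<close>\<close>

lemma l1_nth_add [simp]: "l1_nth (a + b) i = l1_nth a i + l1_nth b i"
  by (simp add: plus_l1.rep_eq)

lemma l1_nth_diff [simp]: "l1_nth (a - b) i = l1_nth a i - l1_nth b i"
  by (simp add: minus_l1.rep_eq)

lemma l1_nth_scaleR [simp]: "l1_nth (c *\<^sub>R a) i = c * l1_nth a i"
  by (simp add: scaleR_l1.rep_eq)

lemma sum_le_norm_l1: "(\<Sum>i<N. \<bar>l1_nth a i\<bar>) \<le> norm a"
  unfolding norm_l1_def by (intro sum_le_suminf summable_l1_nth) auto

lemma l1_nth_le_norm: "\<bar>l1_nth a i\<bar> \<le> norm a"
proof -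
  have "0 \<le> (\<Sum>j<i. \<bar>l1_nth a j\<bar>)" by (intro sum_nonneg) simp
  then show ?thesis using sum_le_norm_l1[of a "Suc i"] unfolding sum.lessThan_Suc by linarith
qed

lemma bounded_linear_l1_nth: "bounded_linear (\<lambda>a. l1_nth a i)"
  by (intro bounded_linear_intro[where K = 1]) (auto simp: l1_nth_le_norm)

text \<open>
  The coordinatewise limit of a Cauchy sequence is its limit in norm: the distances of initial
  segments are bounded uniformly in their length, and these bounds survive the passage to the
  limit.
\<close>

instance l1 :: banach
proof
  fix X :: "nat \<Rightarrow> l1" assume X: "Cauchy X"
  have "Cauchy (\<lambda>n. l1_nth (X n) i)" for i
    by (rule bounded_linear.Cauchy[OF bounded_linear_l1_nth X])
  then have "\<exists>L. \<forall>i. (\<lambda>n. l1_nth (X n) i) \<longlonglongrightarrow> L i"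
    using Cauchy_convergent[where 'a = real] unfolding convergent_def by (intro choice allI) blast
  then obtain L where L: "\<And>i. (\<lambda>n. l1_nth (X n) i) \<longlonglongrightarrow> L i" by blast
  have main: "\<exists>M. \<forall>m\<ge>M. \<forall>N. (\<Sum>i<N. \<bar>l1_nth (X m) i - L i\<bar>) \<le> e" if e: "0 < e" for e
  proof -
    obtain M where M: "\<And>m n. m \<ge> M \<Longrightarrow> n \<ge> M \<Longrightarrow> norm (X m - X n) < e"
      using CauchyD[OF X e] by blast
    have "(\<Sum>i<N. \<bar>l1_nth (X m) i - L i\<bar>) \<le> e" if m: "m \<ge> M" for m N
    proof (rule LIMSEQ_le_const2)
      show "(\<lambda>n. \<Sum>i<N. \<bar>l1_nth (X m) i - l1_nth (X n) i\<bar>) \<longlonglongrightarrow> (\<Sum>i<N. \<bar>l1_nth (X m) i - L i\<bar>)"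
        by (intro tendsto_intros L)
      have "(\<Sum>i<N. \<bar>l1_nth (X m) i - l1_nth (X n) i\<bar>) \<le> e" if "n \<ge> M" for n
        using sum_le_norm_l1[where a = "X m - X n" and N = N] M[OF m that] by simp
      then show "\<exists>k. \<forall>n\<ge>k. (\<Sum>i<N. \<bar>l1_nth (X m) i - l1_nth (X n) i\<bar>) \<le> e" by blast
    qed
    then show ?thesis by blast
  qed
  obtain M where M: "\<And>N. (\<Sum>i<N. \<bar>l1_nth (X M) i - L i\<bar>) \<le> 1" using main[of 1] by auto
  have "summable (\<lambda>i. \<bar>l1_nth (X M) i - L i\<bar>)"
    by (rule summableI_nonneg_bounded[OF _ M]) simp
  then have D: "l1_nth (Abs_l1 (\<lambda>i. l1_nth (X M) i - L i)) = (\<lambda>i. l1_nth (X M) i - L i)"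
    by (intro Abs_l1_inverse) simp
  define a where "a = X M - Abs_l1 (\<lambda>i. l1_nth (X M) i - L i)"
  have a: "l1_nth a i = L i" for i by (simp add: a_def D)
  have "X \<longlonglongrightarrow> a"
  proof (rule LIMSEQ_I)
    fix e :: real assume "0 < e"
    then obtain M where M: "\<And>m N. m \<ge> M \<Longrightarrow> (\<Sum>i<N. \<bar>l1_nth (X m) i - L i\<bar>) \<le> e / 2"
      using main[of "e / 2"] by auto
    have "norm (X m - a) < e" if "m \<ge> M" for m
    proof -
      have "norm (X m - a) \<le> e / 2" unfolding norm_l1_def
        by (rule suminf_le_const[OF summable_l1_nth]) (use M[OF that] in \<open>simp add: a\<close>)
      then show ?thesis using \<open>0 < e\<close> by simp
    qed
    then show "\<exists>no. \<forall>m\<ge>no. norm (X m - a) < e" by blast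
  qed
  then show "convergent X" by (rule convergentI)
qed

lemma convex_cone_l1_pos: "convex_cone l1_pos"
  by (auto simp: convex_cone_iff l1_pos_def zero_l1.rep_eq)

lemma closed_l1_pos: "closed l1_pos"
proof -
  have "l1_pos = (\<Inter>i. {a. 0 \<le> l1_nth a i})" by (auto simp: l1_pos_def)
  moreover have "closed {a. 0 \<le> l1_nth a i}" for i
    by (intro closed_Collect_le continuous_intros linear_continuous_on bounded_linear_l1_nth)
  ultimately show ?thesis by (metis closed_INT)
qed


section \<open>Cones spanned by sequences of James type\<close>

text \<open>
  The matrix of values \<open>f n (x k)\<close> vanishes below the diagonal and is nearly 1 on and above it.
  The errors are so small that the nonzero values lie between 1/2 and 2 and that even the doubled
  errors sum to 1/4 only.
\<close>

locale james_system =
  fixes x :: "nat \<Rightarrow> 'a::banach" and f :: "nat \<Rightarrow> 'a \<Rightarrow>\<^sub>L real" and C :: real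
  assumes C: "0 < C" and norm_x: "norm (x n) \<le> 1" and norm_f: "norm (f n) \<le> C"
    and f_zero: "k < n \<Longrightarrow> blinfun_apply (f n) (x k) = 0"
    and f_near_one: "n \<le> k \<Longrightarrow> \<bar>blinfun_apply (f n) (x k) - 1\<bar> < (1/2)^(k+4)"
begin

definition synth :: "l1 \<Rightarrow> 'a" where
  "synth a = (\<Sum>k. l1_nth a k *\<^sub>R x k)"

lemma norm_term: "norm (l1_nth a k *\<^sub>R x k) \<le> \<bar>l1_nth a k\<bar>"
  using norm_x[of k] by (simp add: mult_left_le)

lemma summable_norm_term: "summable (\<lambda>k. norm (l1_nth a k *\<^sub>R x k))"
  by (rule summable_comparison_test'[OF summable_l1_nth[of a]]) (use norm_term in simp)

lemma summable_term: "summable (\<lambda>k. l1_nth a k *\<^sub>R x k)"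
  by (rule summable_norm_cancel[OF summable_norm_term])

lemma norm_synth_le: "norm (synth a) \<le> norm a"
proof -
  have "norm (synth a) \<le> (\<Sum>k. norm (l1_nth a k *\<^sub>R x k))"
    unfolding synth_def by (rule summable_norm[OF summable_norm_term])
  also have "\<dots> \<le> norm a" unfolding norm_l1_def
    by (rule suminf_le[OF norm_term summable_norm_term summable_l1_nth])
  finally show ?thesis .
qed

lemma bounded_linear_synth: "bounded_linear synth"
proof (rule bounded_linear_intro[where K = 1])
  show "synth (a + b) = synth a + synth b" for a b
    unfolding synth_def by (simp add: scaleR_add_left suminf_add summable_term)
  show "synth (c *\<^sub>R a) = c *\<^sub>R synth a" for c a
    unfolding synth_def by (simp add: suminf_scaleR_right[OF summable_term] flip: scaleR_scaleR)
qed (simp add: norm_synth_le)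

lemma apply_synth_sums: "(\<lambda>k. l1_nth a k * blinfun_apply g (x k)) sums blinfun_apply g (synth a)"
proof -
  have "(\<lambda>k. blinfun_apply g (l1_nth a k *\<^sub>R x k)) sums blinfun_apply g (synth a)"
    unfolding synth_def by (intro bounded_linear.sums[OF blinfun.bounded_linear_right] summable_sums summable_term)
  then show ?thesis by (simp add: blinfun.scaleR_right)
qed

lemma abs_f_le: "\<bar>blinfun_apply (f n) y\<bar> \<le> C * norm y"
  using norm_blinfun[of "f n" y] mult_right_mono[OF norm_f[of n] norm_ge_zero[of y]] by simp

text \<open>
  On the vectors \<open>x k\<close> the functional \<open>f i - f (i + 1)\<close> is close to the Kronecker delta, with
  errors at most \<open>(1/2)^(k+3)\<close>, whose sum is 1/4.  Applied to \<open>synth a\<close> it therefore returns \<open>a\<^sub>i\<close> up to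
  a quarter of the supremum \<open>s\<close> of all coordinates, and taking the supremum over \<open>i\<close> absorbs this
  error.
\<close>

lemma coordinate_le: "\<bar>l1_nth a n\<bar> \<le> 4 * C * norm (synth a)"
proof -
  \<comment> \<open>Finite, since the coordinates are bounded by the norm of \<open>a\<close>.\<close>
  define s where "s = (SUP i. \<bar>l1_nth a i\<bar>)"
  have bdd: "bdd_above (range (\<lambda>i. \<bar>l1_nth a i\<bar>))" using l1_nth_le_norm by (rule bdd_aboveI2)
  have s: "\<bar>l1_nth a i\<bar> \<le> s" for i unfolding s_def by (rule cSUP_upper[OF _ bdd]) simp
  then have s0: "0 \<le> s" by (rule order_trans[OF abs_ge_zero])
  have "\<bar>l1_nth a i\<bar> \<le> 2 * C * norm (synth a) + s / 4" for i
  proof -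
    define g where "g = f i - f (Suc i)"
    have g: "\<bar>(if k = i then 1 else 0) - blinfun_apply g (x k)\<bar> \<le> (1/2)^(k+3)" for k
    proof (cases k i rule: linorder_cases)
      case less then show ?thesis by (simp add: g_def blinfun.diff_left f_zero)
    next
      case equal
      have "(1/2::real)^(k+4) \<le> (1/2)^(k+3)" by (rule power_decreasing) auto
      moreover have "\<bar>blinfun_apply (f i) (x k) - 1\<bar> < (1/2)^(k+4)"
        using equal by (intro f_near_one) simp
      ultimately have "\<bar>1 - blinfun_apply (f i) (x k)\<bar> \<le> (1/2)^(k+3)" by linarith
      then show ?thesis
        using equal f_zero[of i "Suc i"] by (simp add: g_def blinfun.diff_left)
    next
      case greater
      have "(1/2::real)^(k+3) = 2 * (1/2)^(k+4)" by (simp add: eval_nat_numeral)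
      then show ?thesis
        using greater f_near_one[of i k] f_near_one[of "Suc i" k] by (simp add: g_def blinfun.diff_left)
    qed
    have "(\<lambda>k. if k = i then l1_nth a k else 0) sums l1_nth a i" by (rule sums_single)
    then have "(\<lambda>k. (if k = i then l1_nth a k else 0) - l1_nth a k * blinfun_apply g (x k)) sums
        (l1_nth a i - blinfun_apply g (synth a))"
      by (rule sums_diff[OF _ apply_synth_sums])
    moreover have "(\<lambda>k. (if k = i then l1_nth a k else 0) - l1_nth a k * blinfun_apply g (x k)) =
       (\<lambda>k. l1_nth a k * ((if k = i then 1 else 0) - blinfun_apply g (x k)))"
      by (auto simp: algebra_simps)
    ultimately have sums: "(\<lambda>k. l1_nth a k * ((if k = i then 1 else 0) - blinfun_apply g (x k))) sums
        (l1_nth a i - blinfun_apply g (synth a))" by simp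
    have geo: "(\<lambda>k. s * (1/2)^(k+3)) sums (s / 4)"
      using sums_mult[OF power_half_series, of "s / 4"] by (simp add: power_add field_simps)
    have term_le: "norm (l1_nth a k * ((if k = i then 1 else 0) - blinfun_apply g (x k))) \<le> s * (1/2)^(k+3)" for k
      unfolding real_norm_def abs_mult using s s0 g by (intro mult_mono) auto
    have "\<bar>l1_nth a i - blinfun_apply g (synth a)\<bar> \<le> s / 4"
      using norm_suminf_le[OF term_le sums_summable[OF geo]] sums_unique[OF sums] sums_unique[OF geo] by simp
    moreover have "\<bar>blinfun_apply g (synth a)\<bar> \<le> 2 * C * norm (synth a)"
      using abs_f_le[of i "synth a"] abs_f_le[of "Suc i" "synth a"] by (simp add: g_def blinfun.diff_left)
    ultimately show ?thesis by linarith
  qed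
  then have "s \<le> 2 * C * norm (synth a) + s / 4" unfolding s_def by (intro cSUP_least) auto
  then have "s \<le> 4 * C * norm (synth a)" using s0 by simp
  then show ?thesis using s[of n] by linarith
qed

lemma inj_synth: "inj synth"
proof (rule injI)
  fix a b assume "synth a = synth b"
  then have "synth (a - b) = 0" by (simp add: linear_diff[OF bounded_linear.linear[OF bounded_linear_synth]])
  then have "l1_nth (a - b) n = 0" for n using coordinate_le[of "a - b" n] by simp
  then show "a = b" by (intro l1_eqI) simp
qed

lemma summable_l1_tail: "summable (\<lambda>k. \<bar>l1_nth c (k + n)\<bar>)"
  using summable_l1_nth by (rule summable_ignore_initial_segment)

text \<open>
  The functional \<open>f n\<close> ignores the first \<open>n\<close> vectors and takes values between 1/2 and 2 on the
  later ones.  It is here that positivity of the coefficients excludes cancellation.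
\<close>

lemma tail_bounds:
  assumes c: "c \<in> l1_pos"
  shows "(\<Sum>k. \<bar>l1_nth c (k + n)\<bar>) \<le> 2 * blinfun_apply (f n) (synth c)"
    and "blinfun_apply (f n) (synth c) \<le> 2 * (\<Sum>k. \<bar>l1_nth c (k + n)\<bar>)"
proof -
  have c0: "0 \<le> l1_nth c k" for k using c by (simp add: l1_pos_def)
  let ?t = "\<lambda>k. l1_nth c (k + n) * blinfun_apply (f n) (x (k + n))"
  have "blinfun_apply (f n) (synth c) = (\<Sum>k. l1_nth c k * blinfun_apply (f n) (x k))"
    by (rule sums_unique[OF apply_synth_sums])
  also have "\<dots> = (\<Sum>k. ?t k) + (\<Sum>k<n. l1_nth c k * blinfun_apply (f n) (x k))"
    by (rule suminf_split_initial_segment[OF sums_summable[OF apply_synth_sums]])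
  also have "(\<Sum>k<n. l1_nth c k * blinfun_apply (f n) (x k)) = 0" by (simp add: f_zero)
  finally have eq: "blinfun_apply (f n) (synth c) = (\<Sum>k. ?t k)" by simp
  have sm: "summable ?t"
    by (rule summable_ignore_initial_segment[OF sums_summable[OF apply_synth_sums]])
  have near: "1/2 \<le> blinfun_apply (f n) (x (k + n))" "blinfun_apply (f n) (x (k + n)) \<le> 2" for k
  proof -
    have "(1/2::real)^(k+n+4) \<le> (1/2)^1" by (rule power_decreasing) auto
    then show "1/2 \<le> blinfun_apply (f n) (x (k + n))" "blinfun_apply (f n) (x (k + n)) \<le> 2"
      using f_near_one[of n "k + n"] by auto
  qed
  have t: "l1_nth c (k + n) * (1/2) \<le> ?t k" "?t k \<le> l1_nth c (k + n) * 2" for k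
    by (intro mult_left_mono near c0)+
  have "\<bar>l1_nth c (k + n)\<bar> \<le> 2 * ?t k" for k using t(1)[of k] c0[of "k + n"] by simp
  then have "(\<Sum>k. \<bar>l1_nth c (k + n)\<bar>) \<le> (\<Sum>k. 2 * ?t k)"
    by (rule suminf_le[OF _ summable_l1_tail summable_mult[OF sm]])
  then show "(\<Sum>k. \<bar>l1_nth c (k + n)\<bar>) \<le> 2 * blinfun_apply (f n) (synth c)"
    using eq by (simp add: suminf_mult[OF sm])
  have "?t k \<le> 2 * \<bar>l1_nth c (k + n)\<bar>" for k using t(2)[of k] c0[of "k + n"] by simp
  then have "(\<Sum>k. ?t k) \<le> (\<Sum>k. 2 * \<bar>l1_nth c (k + n)\<bar>)"
    by (rule suminf_le[OF _ sm summable_mult[OF summable_l1_tail]])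
  then show "blinfun_apply (f n) (synth c) \<le> 2 * (\<Sum>k. \<bar>l1_nth c (k + n)\<bar>)"
    using eq by (simp add: suminf_mult[OF summable_l1_tail])
qed

text \<open>
  Fix an index \<open>N\<close> beyond which one member \<open>c M\<close> has little mass.  By the tail bounds, all later
  members have little mass beyond \<open>N\<close> as well, and the finitely many remaining coordinates are
  governed by \<open>coordinate_le\<close>.
\<close>

lemma Cauchy_of_Cauchy_synth:
  assumes c: "\<And>m. c m \<in> l1_pos" and cau: "Cauchy (\<lambda>m. synth (c m))"
  shows "Cauchy c"
proof (rule CauchyI)
  fix e :: real assume e: "0 < e"
  \<comment> \<open>Two tails of at most \<open>6 h\<close> each and an initial part of at most \<open>h\<close> add up to less than \<open>e\<close>.\<close>
  define h where "h = e / 14"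
  have h: "0 < h" using e by (simp add: h_def)
  obtain M where M: "\<And>m l. m \<ge> M \<Longrightarrow> l \<ge> M \<Longrightarrow> norm (synth (c m) - synth (c l)) < h / C"
    using CauchyD[OF cau, of "h / C"] h C by auto
  obtain N where "\<forall>n\<ge>N. norm (\<Sum>k. \<bar>l1_nth (c M) (k + n)\<bar>) < h"
    using suminf_exist_split[OF h summable_l1_nth[of "c M"]] by blast
  then have N: "(\<Sum>k. \<bar>l1_nth (c M) (k + N)\<bar>) < h"
    by (metis abs_ge_self le_less_trans order_refl real_norm_def)
  have tail: "(\<Sum>k. \<bar>l1_nth (c m) (k + N)\<bar>) \<le> 6 * h" if m: "m \<ge> M" for m
  proof -
    have "C * norm (synth (c m) - synth (c M)) \<le> h"
      using M[OF m order_refl] C by (simp add: field_simps)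
    then have "blinfun_apply (f N) (synth (c m)) \<le> blinfun_apply (f N) (synth (c M)) + h"
      using abs_f_le[of N "synth (c m) - synth (c M)"] by (simp add: blinfun.diff_right)
    then show ?thesis using tail_bounds(1)[OF c, of m N] tail_bounds(2)[OF c, of N M] N by linarith
  qed
  obtain M' where M': "\<And>m l. m \<ge> M' \<Longrightarrow> l \<ge> M' \<Longrightarrow>
      norm (synth (c m) - synth (c l)) < h / (4 * C * (N + 1))"
    using CauchyD[OF cau, of "h / (4 * C * (N + 1))"] h C by auto
  have "norm (c m - c l) < e" if m: "m \<ge> max M M'" and l: "l \<ge> max M M'" for m l
  proof -
    let ?D = "norm (synth (c m) - synth (c l))"
    have "norm (c m - c l) = (\<Sum>k. \<bar>l1_nth (c m - c l) (k + N)\<bar>) + (\<Sum>k<N. \<bar>l1_nth (c m - c l) k\<bar>)"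
      unfolding norm_l1_def by (rule suminf_split_initial_segment[OF summable_l1_nth])
    moreover have "(\<Sum>k<N. \<bar>l1_nth (c m - c l) k\<bar>) \<le> h"
    proof -
      have "\<bar>l1_nth (c m - c l) k\<bar> \<le> 4 * C * ?D" for k
        using coordinate_le[of "c m - c l" k]
        by (simp add: linear_diff[OF bounded_linear.linear[OF bounded_linear_synth]])
      then have "(\<Sum>k<N. \<bar>l1_nth (c m - c l) k\<bar>) \<le> (\<Sum>k<N. 4 * C * ?D)" by (intro sum_mono)
      also have "\<dots> \<le> (N + 1) * (4 * C * ?D)" using C by (simp add: algebra_simps)
      also have "\<dots> = ?D * (4 * C * (N + 1))" by (simp add: mult_ac)
      also have "\<dots> \<le> h"
        using M'[of m l] m l C by (intro less_imp_le) (simp add: pos_less_divide_eq)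
      finally show ?thesis .
    qed
    moreover have "(\<Sum>k. \<bar>l1_nth (c m - c l) (k + N)\<bar>) \<le>
        (\<Sum>k. \<bar>l1_nth (c m) (k + N)\<bar> + \<bar>l1_nth (c l) (k + N)\<bar>)"
      by (rule suminf_le[OF _ summable_l1_tail summable_add[OF summable_l1_tail summable_l1_tail]])
         (simp add: abs_triangle_ineq4)
    moreover have "\<dots> = (\<Sum>k. \<bar>l1_nth (c m) (k + N)\<bar>) + (\<Sum>k. \<bar>l1_nth (c l) (k + N)\<bar>)"
      by (rule suminf_add[symmetric, OF summable_l1_tail summable_l1_tail])
    ultimately show ?thesis using tail[of m] tail[of l] m l h by (simp add: h_def)
  qed
  then show "\<exists>M. \<forall>m\<ge>M. \<forall>n\<ge>M. norm (c m - c n) < e" by blast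
qed

text \<open>
  With \<open>y\<close> an arbitrary limit point this makes the image cone closed; with \<open>y\<close> in the image it makes
  the inverse map continuous there.
\<close>

lemma tendsto_of_tendsto_synth:
  assumes c: "\<And>m. c m \<in> l1_pos" and y: "(\<lambda>m. synth (c m)) \<longlonglongrightarrow> y"
  obtains a where "a \<in> l1_pos" "c \<longlonglongrightarrow> a" "synth a = y"
proof -
  have "Cauchy c" by (rule Cauchy_of_Cauchy_synth[OF c LIMSEQ_imp_Cauchy[OF y]])
  then obtain a where a: "c \<longlonglongrightarrow> a" using Cauchy_convergent convergent_def by blast
  show ?thesis
  proof (rule that)
    show "a \<in> l1_pos" by (rule closed_sequentially[OF closed_l1_pos c a])
    show "synth a = y"
      by (rule LIMSEQ_unique[OF bounded_linear.tendsto[OF bounded_linear_synth a] y])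
  qed fact
qed

lemma cone_isomorphic_synth_image: "cone_isomorphic (synth ` l1_pos) l1_pos"
  unfolding cone_isomorphic_def
proof (intro exI conjI ballI allI impI)
  let ?S = "inv_into l1_pos synth"
  have lin: "linear synth" by (rule bounded_linear.linear[OF bounded_linear_synth])
  have inj: "inj_on synth l1_pos" using inj_synth by (rule inj_on_subset) simp
  have S: "?S (synth c) = c" if "c \<in> l1_pos" for c using inj that by (rule inv_into_f_f)
  show bij: "bij_betw ?S (synth ` l1_pos) l1_pos"
    using inj by (intro bij_betw_inv_into) (simp add: bij_betw_def)
  show "?S (u + v) = ?S u + ?S v" if uv: "u \<in> synth ` l1_pos" "v \<in> synth ` l1_pos" for u v
  proof -
    obtain a b where ab: "a \<in> l1_pos" "u = synth a" "b \<in> l1_pos" "v = synth b" using uv by blast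
    have "?S (synth (a + b)) = a + b"
      by (rule S) (use ab convex_cone_add[OF convex_cone_l1_pos] in blast)
    then show ?thesis using ab S by (simp add: linear_add[OF lin])
  qed
  show "?S (t *\<^sub>R u) = t *\<^sub>R ?S u" if u: "u \<in> synth ` l1_pos" and t: "0 \<le> t" for u t
  proof -
    obtain a where a: "a \<in> l1_pos" "u = synth a" using u by blast
    have "?S (synth (t *\<^sub>R a)) = t *\<^sub>R a"
      by (rule S) (use a t convex_cone_scaleR[OF convex_cone_l1_pos] in blast)
    then show ?thesis using a S by (simp add: linear_scale[OF lin])
  qed
  show "continuous_on (synth ` l1_pos) ?S"
    unfolding continuous_on_sequentially
  proof (intro allI impI ballI)
    fix u y assume y: "y \<in> synth ` l1_pos" and u: "(\<forall>n. u n \<in> synth ` l1_pos) \<and> u \<longlonglongrightarrow> y"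
    then have "\<forall>n. \<exists>c. c \<in> l1_pos \<and> synth c = u n" by (metis imageE)
    then obtain c where c: "\<And>n. c n \<in> l1_pos" "\<And>n. synth (c n) = u n" by metis
    then have "(\<lambda>n. synth (c n)) \<longlonglongrightarrow> y" using u by simp
    then obtain a where a: "a \<in> l1_pos" "c \<longlonglongrightarrow> a" "synth a = y"
      using tendsto_of_tendsto_synth[of c y] c(1) by blast
    have "?S \<circ> u = c" using S[OF c(1)] c(2) by (simp add: fun_eq_iff)
    moreover have "?S y = a" using S a by blast
    ultimately show "(?S \<circ> u) \<longlonglongrightarrow> ?S y" using a(2) by simp
  qed
  have "inv_into (synth ` l1_pos) ?S c = synth c" if "c \<in> l1_pos" for c
    by (rule inv_into_f_eq) (use bij that S in \<open>auto simp: bij_betw_def\<close>)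
  then show "continuous_on l1_pos (inv_into (synth ` l1_pos) ?S)"
    using linear_continuous_on[OF bounded_linear_synth] by (simp cong: continuous_on_cong)
qed

lemma closed_synth_image: "closed (synth ` l1_pos)"
  unfolding closed_sequential_limits
proof (intro allI impI)
  fix u y assume u: "(\<forall>n. u n \<in> synth ` l1_pos) \<and> u \<longlonglongrightarrow> y"
  then have "\<forall>n. \<exists>c. c \<in> l1_pos \<and> synth c = u n" by (metis imageE)
  then obtain c where c: "\<And>n. c n \<in> l1_pos" "\<And>n. synth (c n) = u n" by metis
  then have "(\<lambda>n. synth (c n)) \<longlonglongrightarrow> y" using u by simp
  then obtain a where "a \<in> l1_pos" "synth a = y"
    using tendsto_of_tendsto_synth[of c y] c(1) by blast
  then show "y \<in> synth ` l1_pos" by blast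
qed

lemma synth_image_subset:
  assumes P: "convex_cone P" "closed P" and x: "\<And>n. x n \<in> P"
  shows "synth ` l1_pos \<subseteq> P"
proof clarify
  fix c assume "c \<in> l1_pos"
  then have c: "0 \<le> l1_nth c k" for k by (simp add: l1_pos_def)
  have "(\<Sum>k<n. l1_nth c k *\<^sub>R x k) \<in> P" for n
    by (induction n)
       (auto intro!: convex_cone_add[OF P(1)] convex_cone_scaleR[OF P(1)] x c convex_cone_contains_0[OF P(1)])
  moreover have "(\<lambda>n. \<Sum>k<n. l1_nth c k *\<^sub>R x k) \<longlonglongrightarrow> synth c"
    using summable_term unfolding synth_def by (rule summable_LIMSEQ)
  ultimately show "synth c \<in> P" by (rule closed_sequentially[OF P(2)])
qed

end

section \<open>Reflexive cones omit the positive cone of \<open>\<ell>\<^sub>1\<close>\<close>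

text \<open>
  The sets \<open>E N\<close> below consist of the preimages of positive sequences of norm \<open>\<delta>\<close> that
  vanish before \<open>N\<close>.  They violate the finite intersection property characterising compactness.
\<close>

lemma cone_isomorphic_l1_pos_not_reflexive:
  fixes P :: "'a::real_normed_vector set"
  assumes refl: "reflexive_cone P" and KP: "K \<subseteq> P" and K: "convex_cone K" "closed K"
    and iso: "cone_isomorphic K l1_pos"
  shows False
proof -
  obtain T where bij: "bij_betw T K l1_pos"
    and add: "\<And>x y. x \<in> K \<Longrightarrow> y \<in> K \<Longrightarrow> T (x + y) = T x + T y"
    and scale: "\<And>x c. x \<in> K \<Longrightarrow> 0 \<le> c \<Longrightarrow> T (c *\<^sub>R x) = c *\<^sub>R T x"
    and contT: "continuous_on K T" and contR: "continuous_on l1_pos (inv_into K T)"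
    using iso unfolding cone_isomorphic_def by blast
  let ?R = "inv_into K T"
  have RK: "?R c \<in> K" and TR: "T (?R c) = c" if "c \<in> l1_pos" for c
    using bij that by (auto simp: bij_betw_def inv_into_into f_inv_into_f)
  have Tpos: "T x \<in> l1_pos" if "x \<in> K" for x using bij that by (auto simp: bij_betw_def)
  have zero: "0 \<in> K" "0 \<in> l1_pos"
    using convex_cone_contains_0[OF K(1)] by (auto simp: l1_pos_def zero_l1.rep_eq)
  have "T 0 = 0" using scale[OF zero(1), of 0] by simp
  then have R0: "?R 0 = 0" using bij zero(1) by (metis bij_betw_def inv_into_f_f)
  obtain \<delta>' where \<delta>': "0 < \<delta>'" "\<And>c. c \<in> l1_pos \<Longrightarrow> norm c < \<delta>' \<Longrightarrow> norm (?R c) < 1"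
    using contR[unfolded continuous_on_iff, rule_format, OF zero(2), of 1] R0 by auto
  \<comment> \<open>The sphere of radius \<open>\<delta>\<close> lies inside the open ball of radius \<open>\<delta>'\<close>.\<close>
  define \<delta> where "\<delta> = \<delta>' / 2"
  have \<delta>: "0 < \<delta>" "\<And>c. c \<in> l1_pos \<Longrightarrow> norm c = \<delta> \<Longrightarrow> norm (?R c) \<le> 1"
    using \<delta>' by (auto simp: \<delta>_def less_imp_le)
  define D where "D N = {c \<in> l1_pos. norm c = \<delta> \<and> (\<forall>i<N. l1_nth c i = 0)}" for N :: nat
  define E where "E N = {x \<in> K. T x \<in> D N}" for N
  \<comment> \<open>The norm is additive on positive sequences; hence the spherical sets \<open>D N\<close> are convex.\<close>
  have norm_pos: "norm (u *\<^sub>R a + v *\<^sub>R b) = u * norm a + v * norm b"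
    if "a \<in> l1_pos" "b \<in> l1_pos" "0 \<le> u" "0 \<le> v" for a b u v
  proof -
    have "\<bar>l1_nth (u *\<^sub>R a + v *\<^sub>R b) i\<bar> = u * \<bar>l1_nth a i\<bar> + v * \<bar>l1_nth b i\<bar>" for i
      using that by (simp add: l1_pos_def plus_l1.rep_eq scaleR_l1.rep_eq)
    then show ?thesis unfolding norm_l1_def
      by (simp add: suminf_add[symmetric] suminf_mult[symmetric] summable_mult summable_l1_nth)
  qed
  have convE: "convex (E N)" for N
  proof (rule convexI)
    fix x y and u v :: real assume xy: "x \<in> E N" "y \<in> E N" and uv: "0 \<le> u" "0 \<le> v" "u + v = 1"
    then have K': "u *\<^sub>R x \<in> K" "v *\<^sub>R y \<in> K"
      by (auto simp: E_def intro: convex_cone_scaleR[OF K(1)])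
    have T: "T (u *\<^sub>R x + v *\<^sub>R y) = u *\<^sub>R T x + v *\<^sub>R T y"
      using add[OF K'] scale uv xy by (simp add: E_def)
    have "norm (u *\<^sub>R T x + v *\<^sub>R T y) = (u + v) * \<delta>"
      using norm_pos[OF _ _ uv(1,2), of "T x" "T y"] xy by (simp add: E_def D_def distrib_right)
    moreover have "u *\<^sub>R x + v *\<^sub>R y \<in> K" by (rule convex_cone_add[OF K(1) K'])
    ultimately show "u *\<^sub>R x + v *\<^sub>R y \<in> E N"
      using T xy uv(3) Tpos[of "u *\<^sub>R x + v *\<^sub>R y"]
      by (simp add: E_def D_def plus_l1.rep_eq scaleR_l1.rep_eq)
  qed
  have "closed (D N)" for N
  proof -
    have "D N = l1_pos \<inter> {c. norm c = \<delta>} \<inter> (\<Inter>i\<in>{..<N}. {c. l1_nth c i = 0})"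
      by (auto simp: D_def)
    moreover have "closed {c. l1_nth c i = 0}" for i
      by (intro closed_Collect_eq continuous_intros linear_continuous_on bounded_linear_l1_nth)
    moreover have "closed {c :: l1. norm c = \<delta>}" by (intro closed_Collect_eq continuous_intros)
    ultimately show ?thesis
      using closed_l1_pos by (metis (no_types, lifting) closed_INT closed_Int)
  qed
  then have closedE: "closed (E N)" for N
    unfolding E_def using continuous_closed_preimage[OF contT K(2)]
    by (simp add: vimage_def Int_def)
  have E_ball: "E N \<subseteq> P \<inter> cball 0 1" for N
  proof
    fix x assume x: "x \<in> E N"
    then have "?R (T x) = x" using bij by (auto simp: E_def bij_betw_def)
    moreover have "norm (?R (T x)) \<le> 1" using x by (intro \<delta>) (auto simp: E_def D_def)
    ultimately show "x \<in> P \<inter> cball 0 1" using x KP by (auto simp: E_def)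
  qed
  have neE: "E N \<noteq> {}" for N
  proof -
    define c where "c = Abs_l1 (\<lambda>i. if i = N then \<delta> else 0)"
    have sums: "(\<lambda>i. if i = N then \<delta> else 0) sums \<delta>" by (rule sums_single)
    have eq: "(\<lambda>i. \<bar>if i = N then \<delta> else 0\<bar>) = (\<lambda>i. if i = N then \<delta> else 0)"
      using \<delta>(1) by auto
    have c: "l1_nth c = (\<lambda>i. if i = N then \<delta> else 0)"
      unfolding c_def by (rule Abs_l1_inverse) (use sums_summable[OF sums] in \<open>simp add: eq\<close>)
    have "norm c = \<delta>" unfolding norm_l1_def c eq by (rule sums_unique[OF sums, symmetric])
    then have cD: "c \<in> D N" using \<delta>(1) by (simp add: D_def l1_pos_def c)
    then have "c \<in> l1_pos" by (simp add: D_def)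
    then have "?R c \<in> E N" using RK TR cD by (simp add: E_def)
    then show ?thesis by blast
  qed
  have mono: "E N \<subseteq> E M" if "M \<le> N" for M N using that by (auto simp: E_def D_def)
  have "(P \<inter> cball 0 1) \<inter> \<Inter>(range E) \<noteq> {}"
  proof -
    have comp: "compactin weak_topology (P \<inter> cball 0 1)" using refl by (simp add: reflexive_cone_def)
    have "\<forall>C\<in>range E. closedin weak_topology C"
      using closedin_weak_closed_convex[OF closedE convE] by blast
    moreover have "(P \<inter> cball 0 1) \<inter> \<Inter>\<F> \<noteq> {}" if F: "finite \<F>" "\<F> \<subseteq> range E" for \<F>
    proof -
      obtain I where I: "finite I" "\<F> = E ` I" using finite_subset_image[OF F] by blast
      obtain N where N: "\<forall>i\<in>I. i \<le> N" using I(1) finite_nat_set_iff_bounded_le by blast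
      obtain x where "x \<in> E N" using neE by blast
      then have "x \<in> (P \<inter> cball 0 1) \<inter> \<Inter>\<F>" using E_ball N mono I(2) by blast
      then show ?thesis by blast
    qed
    ultimately show ?thesis using comp[unfolded compactin_fip] by blast
  qed
  then obtain x where x: "\<And>N. x \<in> E N" by blast
  have "l1_nth (T x) i = 0" for i using x[of "Suc i"] by (simp add: E_def D_def)
  then have "norm (T x) = 0" by (simp add: norm_l1_def)
  then show False using x[of 0] \<delta>(1) by (simp add: E_def D_def)
qed

section \<open>Reflexivity and the positive cone of \<open>\<ell>\<^sub>1\<close>\<close>

theorem theorem4p5:
  fixes P :: "'a::banach set"
  assumes "convex_cone P" and "closed P"
  shows "reflexive_cone P \<longleftrightarrow>
    \<not> (\<exists>K. K \<subseteq> P \<and> convex_cone K \<and> closed K \<and> cone_isomorphic K l1_pos)"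
proof
  assume "reflexive_cone P"
  then show "\<not> (\<exists>K. K \<subseteq> P \<and> convex_cone K \<and> closed K \<and> cone_isomorphic K l1_pos)"
    using cone_isomorphic_l1_pos_not_reflexive by blast
next
  assume no_cone: "\<not> (\<exists>K. K \<subseteq> P \<and> convex_cone K \<and> closed K \<and> cone_isomorphic K l1_pos)"
  show "reflexive_cone P"
  proof (rule ccontr)
    assume "\<not> reflexive_cone P"
    then have not_compact: "\<not> compactin weak_topology (P \<inter> cball 0 1)"
      using assms(1) by (simp add: reflexive_cone_def)
    have "closed (P \<inter> cball 0 1)" "convex (P \<inter> cball 0 1)" "P \<inter> cball 0 1 \<subseteq> cball 0 1"
      using assms by (auto simp: convex_cone_def intro: convex_Int)
    from non_weakly_compact_limit[OF this not_compact]
    obtain F :: "('a \<Rightarrow>\<^sub>L real) \<Rightarrow> real" and d where F: "linear F" "0 < d"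
      "\<forall>S e. finite S \<longrightarrow> 0 < e \<longrightarrow> (\<exists>x\<in>P \<inter> cball 0 1. \<forall>f\<in>S. \<bar>blinfun_apply f x - F f\<bar> < e)"
      "\<forall>x c. (\<forall>f. \<bar>F f - blinfun_apply f x\<bar> \<le> c * norm f) \<longrightarrow> d \<le> c"
      by blast
    obtain C x f where seq: "0 < C" "\<And>n. x n \<in> P \<inter> cball 0 1"
      "\<And>n. norm (f n :: 'a \<Rightarrow>\<^sub>L real) \<le> C"
      "\<And>n k. k < n \<Longrightarrow> blinfun_apply (f n) (x k) = 0"
      "\<And>n k. n \<le> k \<Longrightarrow> \<bar>blinfun_apply (f n) (x k) - 1\<bar> < (1/2)^(k+4)"
      using james_sequence[OF F, of "\<lambda>k. (1/2)^(k+4)"] by (auto simp del: Int_iff)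
    have x: "x n \<in> P" "norm (x n) \<le> 1" for n using seq(2)[of n] by auto
    interpret james_system x f C by unfold_locales (use seq x in auto)
    have "synth ` l1_pos \<subseteq> P" by (rule synth_image_subset[OF assms x(1)])
    moreover have "convex_cone (synth ` l1_pos)"
      using convex_cone_linear_image convex_cone_l1_pos bounded_linear.linear[OF bounded_linear_synth]
      by blast
    ultimately show False
      using no_cone closed_synth_image cone_isomorphic_synth_image by blast
  qed
qed

end
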